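(* There exist universal constants $\bar c,C>0$ such that the following holds. For every $n\ge 1$, every finite $n$-player game with losses in $[0,1]$ in which player $i$ has $d_i\ge1$ actions, and every integer $T\ge1$, if all players use Optimistic Hedge (under exact expected loss-vector feedback) with the common constant step size $\eta_T=\bar c/[\sqrt n\,\log(T+2)]$, then, with $d=\max_i d_i$ and $\widehat\mu_T=\frac1T\sum_{t=1}^T\bigotimes_{j\in[n]}x_j^t$, $$\mathrm{Gap}_{\mathrm{CCE}}(\widehat\mu_T)\le\frac{C\sqrt n\,\log d\,\log(T+2)}{T}.$$
   Context: Game. There are $n$ players; player $i\in[n]$ has action set $A_i=[d_i]=\{1,\dots,d_i\}$, $A=\prod_j A_j$, $A_{-i}=\prod_{j\ne i}A_j$, and loss function $\ell_i:A\to[0,1]$. $\Delta_d=\{x\in\mathbb R_{\ge0}^d:\sum_a x_a=1\}$. For mixed strategies $x_j\in\Delta_{d_j}$, the expected loss vector is $\ell_i(x_{-i})\in[0,1]^{d_i}$ with $[\ell_i(x_{-i})]_{a_i}=\sum_{a_{-i}\in A_{-i}}\ell_i(a_i,a_{-i})\prod_{j\ne i}x_{j,a_j}$. Optimistic Hedge self-play with step size $\eta>0$. For every player $i$: $x_i^1$ is uniform on $A_i$, $\ell_i^0=0\in\mathbb R^{d_i}$, and for every $t\ge1$, $\ell_i^t=\ell_i(x_{-i}^t)$ and $$x_{i,a}^{t+1}=\frac{x_{i,a}^t\exp\{-\eta(2\ell_{i,a}^t-\ell_{i,a}^{t-1})\}}{\sum_{b\in A_i}x_{i,b}^t\exp\{-\eta(2\ell_{i,b}^t-\ell_{i,b}^{t-1})\}},\qquad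 a\in A_i.$$ Coarse correlated equilibrium gap of a probability distribution $\mu$ on $A$: $\mathrm{Gap}_{\mathrm{CCE}}(\mu)=\max_{i\in[n]}\max_{a_i'\in A_i}\mathbb E_{a\sim\mu}[\ell_i(a)-\ell_i(a_i',a_{-i})]$. $\bigotimes_j x_j^t$ is the product distribution on $A$ with marginals $x_j^t$. "Universal constant" means an absolute constant, independent of $n$, the $d_j$, the losses and $T$. *)

theory Defs
  imports Complex_Main "HOL-Library.FuncSet"
begin

text \<open>
  Players are \<open>{1..n}\<close>, player \<open>i\<close> has actions \<open>{1..d i}\<close>, and an action profile is an
  extensional function. The loss of player \<open>i\<close> is \<open>L i\<close>, of interest on \<open>profiles n d\<close> only.
\<close>

definition profiles :: "nat \<Rightarrow> (nat \<Rightarrow> nat) \<Rightarrow> (nat \<Rightarrow> nat) set" where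
  "profiles n d = (\<Pi>\<^sub>E j\<in>{1..n}. {1..d j})"

definition profiles_without :: "nat \<Rightarrow> (nat \<Rightarrow> nat) \<Rightarrow> nat \<Rightarrow> (nat \<Rightarrow> nat) set" where
  "profiles_without n d i = (\<Pi>\<^sub>E j\<in>{1..n} - {i}. {1..d j})"

definition is_game :: "nat \<Rightarrow> (nat \<Rightarrow> nat) \<Rightarrow> (nat \<Rightarrow> (nat \<Rightarrow> nat) \<Rightarrow> real) \<Rightarrow> bool" where
  "is_game n d L \<longleftrightarrow>
     n \<ge> 1 \<and> (\<forall>i\<in>{1..n}. d i \<ge> 1) \<and> (\<forall>i\<in>{1..n}. \<forall>a\<in>profiles n d. 0 \<le> L i a \<and> L i a \<le> 1)"

text \<open>
  The entry at action \<open>b\<close> of the expected loss vector of player \<open>i\<close> under the mixed strategies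
  \<open>x\<close>, where \<open>x j a\<close> is the probability that player \<open>j\<close> plays \<open>a\<close>. The strategy \<open>x i\<close> is not used.
\<close>

definition expected_loss ::
  "nat \<Rightarrow> (nat \<Rightarrow> nat) \<Rightarrow> (nat \<Rightarrow> (nat \<Rightarrow> nat) \<Rightarrow> real) \<Rightarrow>
   (nat \<Rightarrow> nat \<Rightarrow> real) \<Rightarrow> nat \<Rightarrow> nat \<Rightarrow> real" where
  "expected_loss n d L x i b =
     (\<Sum>a\<in>profiles_without n d i. L i (a(i := b)) * (\<Prod>j\<in>{1..n} - {i}. x j (a j)))"

text \<open>
  \<open>x t i a\<close> is the probability of action \<open>a\<close> for player \<open>i\<close> in round \<open>t \<ge> 1\<close>; \<open>x 0\<close> is irrelevant.
\<close>

definition feedback ::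
  "nat \<Rightarrow> (nat \<Rightarrow> nat) \<Rightarrow> (nat \<Rightarrow> (nat \<Rightarrow> nat) \<Rightarrow> real) \<Rightarrow>
   (nat \<Rightarrow> nat \<Rightarrow> nat \<Rightarrow> real) \<Rightarrow> nat \<Rightarrow> nat \<Rightarrow> nat \<Rightarrow> real" where
  "feedback n d L x t i a = (if t = 0 then 0 else expected_loss n d L (x t) i a)"

definition optimistic_hedge_play ::
  "nat \<Rightarrow> (nat \<Rightarrow> nat) \<Rightarrow> (nat \<Rightarrow> (nat \<Rightarrow> nat) \<Rightarrow> real) \<Rightarrow> real \<Rightarrow>
   (nat \<Rightarrow> nat \<Rightarrow> nat \<Rightarrow> real) \<Rightarrow> bool" where
  "optimistic_hedge_play n d L \<eta> x \<longleftrightarrow>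
     (\<forall>i\<in>{1..n}. \<forall>a\<in>{1..d i}. x 1 i a = 1 / real (d i)) \<and>
     (\<forall>t\<ge>1. \<forall>i\<in>{1..n}. \<forall>a\<in>{1..d i}.
        x (t + 1) i a =
          x t i a * exp (- \<eta> * (2 * feedback n d L x t i a - feedback n d L x (t - 1) i a)) /
          (\<Sum>b\<in>{1..d i}.
             x t i b * exp (- \<eta> * (2 * feedback n d L x t i b - feedback n d L x (t - 1) i b))))"

text \<open>Distributions on \<open>profiles n d\<close> are given by their probability mass functions.\<close>

definition product_dist :: "nat \<Rightarrow> (nat \<Rightarrow> nat \<Rightarrow> real) \<Rightarrow> (nat \<Rightarrow> nat) \<Rightarrow> real" where
  "product_dist n x a = (\<Prod>j\<in>{1..n}. x j (a j))"

definition average_play :: "nat \<Rightarrow> nat \<Rightarrow> (nat \<Rightarrow> nat \<Rightarrow> nat \<Rightarrow> real) \<Rightarrow> (nat \<Rightarrow> nat) \<Rightarrow> real" where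
  "average_play n T x a = 1 / real T * (\<Sum>t\<in>{1..T}. product_dist n (x t) a)"

definition Gap_CCE ::
  "nat \<Rightarrow> (nat \<Rightarrow> nat) \<Rightarrow> (nat \<Rightarrow> (nat \<Rightarrow> nat) \<Rightarrow> real) \<Rightarrow> ((nat \<Rightarrow> nat) \<Rightarrow> real) \<Rightarrow> real" where
  "Gap_CCE n d L \<mu> =
     (MAX i\<in>{1..n}. MAX b\<in>{1..d i}. \<Sum>a\<in>profiles n d. \<mu> a * (L i a - L i (a(i := b))))"

end

theory Submission
  imports Defs
begin

text \<open>
  By a log-partition function argument, the regret of a player is at most
  \<open>ln d / \<eta> + \<eta> (\<Sum>\<^sub>t Var (l\<^sub>t - l\<^sub>t\<^sub>-\<^sub>1) - 1/4 \<Sum>\<^sub>t Var l\<^sub>t\<^sub>-\<^sub>1)\<close>, with variances under the player's strategy.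
  In self-play the loss sequences are smooth: their \<open>h\<close>-th differences are at most
  \<open>h! / R\<^sup>h\<close> for \<open>h \<le> H \<le> R\<close>, where \<open>R\<close> is of order \<open>1 / (\<eta> sqrt n)\<close>, hence of order \<open>log T\<close>. This is an
  induction on \<open>h\<close>: the strategies are Gibbs measures of summed losses, so \<open>h\<close>-th differences of
  strategies, and then of losses, only involve differences of losses of order less than \<open>h\<close>.
  The ratios of the energies of consecutive differences are almost increasing (log-convexity), and
  for \<open>H\<close> of order \<open>log T\<close> the energy of the \<open>H\<close>-th difference is negligible. So the energy of
  \<open>l\<^sub>t - l\<^sub>t\<^sub>-\<^sub>1\<close> is at most a quarter of that of \<open>l\<^sub>t\<^sub>-\<^sub>1\<close>, up to a constant, which leaves a
  regret of order \<open>ln d / \<eta>\<close>.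
\<close>

section \<open>Finite differences and window norms\<close>

text \<open>An absolute bound on \<open>l_t - l_{t-1}\<close> would not do: at this step size it
  leaves a term growing with \<open>T\<close>. The variation has to be bounded relative to the
  variance of \<open>l\<close>, even where that variance is tiny. Log-convexity does this: if the
  first energy ratio exceeded 1/4, all later ratios would stay near that level or above, and the
  energy of the \<open>H\<close>-th difference would be larger than smoothness permits. This fixes
  the step size. The energy of the \<open>H\<close>-th difference must be negligible after summation
  over \<open>T\<close> rounds, so \<open>H\<close> is of order log \<open>T\<close>; and
  \<open>h! / R^h\<close> decays geometrically up to \<open>h = H\<close> only if \<open>R\<close>
  is a large multiple of \<open>H\<close>. Hence \<open>\<eta>\<close> is of order
  \<open>1 / (sqrt n log T)\<close>. The energies are weighted by the changing strategies. A weight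
  changes by a factor \<open>exp (O(\<eta>))\<close> per round, and each order of difference pays
  one such factor, so \<open>H\<close> orders cost \<open>exp (O(\<eta> H))\<close>, which is
  bounded.\<close>

definition fdiff :: "(nat \<Rightarrow> real) \<Rightarrow> nat \<Rightarrow> real" where
  "fdiff f t = f (Suc t) - f t"

abbreviation fdiffs :: "nat \<Rightarrow> (nat \<Rightarrow> real) \<Rightarrow> nat \<Rightarrow> real" where
  "fdiffs k \<equiv> fdiff ^^ k"

lemma fdiffs_Suc: "fdiffs (Suc k) f t = fdiffs k f (Suc t) - fdiffs k f t"
  by (simp add: fdiff_def)

text \<open>A \<open>k\<close>-th difference is a fixed linear combination of \<open>k + 1\<close>
  consecutive values. This gives locality, shift invariance and passage to limits, and later lets
  the square of a difference be expanded as a double sum over times.\<close>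

lemma fdiffs_coeffs:
  "\<exists>c. \<forall>f t. fdiffs k f t = (\<Sum>s\<le>k. c s * f (t + s))"
proof (induction k)
  case 0
  show ?case by (rule exI[of _ "\<lambda>_. 1"]) simp
next
  case (Suc k)
  then obtain c where c: "\<And>f t. fdiffs k f t = (\<Sum>s\<le>k. c s * f (t + s))" by blast
  define c' where "c' s = (if s = 0 then 0 else c (s - 1)) - (if s \<le> k then c s else 0)" for s
  have "fdiffs (Suc k) f t = (\<Sum>s\<le>Suc k. c' s * f (t + s))" for f t
  proof -
    have "(\<Sum>s\<le>Suc k. (if s = 0 then 0 else c (s - 1)) * f (t + s)) = (\<Sum>s\<le>k. c s * f (Suc t + s))"
      by (subst sum.atMost_Suc_shift) simp
    moreover have "(\<Sum>s\<le>Suc k. (if s \<le> k then c s else 0) * f (t + s)) = (\<Sum>s\<le>k. c s * f (t + s))"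
      by simp
    ultimately show ?thesis
      unfolding fdiffs_Suc c c'_def left_diff_distrib sum_subtractf by simp
  qed
  then show ?case by blast
qed

lemma fdiffs_cong:
  assumes "\<And>s. s \<le> k \<Longrightarrow> f (t + s) = g (t + s)"
  shows "fdiffs k f t = fdiffs k g t"
proof -
  obtain c where c: "\<And>f t. fdiffs k f t = (\<Sum>s\<le>k. c s * f (t + s))" using fdiffs_coeffs by blast
  show ?thesis unfolding c using assms by (intro sum.cong) auto
qed

lemma fdiffs_shift: "fdiffs k (\<lambda>s. f (t + s)) s = fdiffs k f (t + s)"
proof -
  obtain c where c: "\<And>f t. fdiffs k f t = (\<Sum>s\<le>k. c s * f (t + s))" using fdiffs_coeffs by blast
  show ?thesis by (simp add: c add.assoc)
qed

lemma fdiffs_add: "fdiffs k (\<lambda>s. f s + g s) t = fdiffs k f t + fdiffs k g t"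
  by (induction k arbitrary: t) (simp_all add: fdiff_def)

lemma fdiffs_cmult: "fdiffs k (\<lambda>s. c * f s) t = c * fdiffs k f t"
  by (induction k arbitrary: t) (simp_all add: fdiff_def algebra_simps)

lemma fdiffs_diff: "fdiffs k (\<lambda>s. f s - g s) t = fdiffs k f t - fdiffs k g t"
  by (induction k arbitrary: t) (simp_all add: fdiff_def)

lemma fdiffs_sum: "fdiffs k (\<lambda>s. \<Sum>a\<in>A. f a s) t = (\<Sum>a\<in>A. fdiffs k (f a) t)"
proof -
  obtain c where c: "\<And>f t. fdiffs k f t = (\<Sum>s\<le>k. c s * f (t + s))" using fdiffs_coeffs by blast
  show ?thesis unfolding c sum_distrib_left by (rule sum.swap)
qed

lemma fdiffs_const: "k > 0 \<Longrightarrow> fdiffs k (\<lambda>_. c) t = 0"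
proof -
  have "fdiffs (Suc k) (\<lambda>_. c) t = 0" for k t
    by (induction k arbitrary: t) (simp_all add: fdiff_def)
  then show "k > 0 \<Longrightarrow> fdiffs k (\<lambda>_. c) t = 0" using gr0_conv_Suc by auto
qed

lemma fdiffs_Suc_fdiff: "fdiffs (Suc k) f t = fdiffs k (fdiff f) t"
  by (simp add: funpow_swap1)

lemma sum_Pascal:
  fixes F :: "nat \<Rightarrow> nat \<Rightarrow> real"
  shows "(\<Sum>k\<le>m. real (m choose k) * (F (Suc k) (m - k) + F k (Suc (m - k)))) =
         (\<Sum>k\<le>Suc m. real (Suc m choose k) * F k (Suc m - k))"
proof -
  have "(\<Sum>k\<le>m. real (m choose k) * F k (Suc (m - k))) = (\<Sum>k\<le>Suc m. real (m choose k) * F k (Suc m - k))"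
    by (simp add: Suc_diff_le)
  also have "\<dots> = F 0 (Suc m) + (\<Sum>k\<le>m. real (m choose Suc k) * F (Suc k) (m - k))"
    by (subst sum.atMost_Suc_shift) simp
  finally have 1: "(\<Sum>k\<le>m. real (m choose k) * F k (Suc (m - k))) =
    F 0 (Suc m) + (\<Sum>k\<le>m. real (m choose Suc k) * F (Suc k) (m - k))" .
  have "(\<Sum>k\<le>Suc m. real (Suc m choose k) * F k (Suc m - k)) =
      F 0 (Suc m) + (\<Sum>k\<le>m. real (Suc m choose Suc k) * F (Suc k) (m - k))"
    by (subst sum.atMost_Suc_shift) simp
  also have "\<dots> = F 0 (Suc m) + (\<Sum>k\<le>m. real (m choose Suc k) * F (Suc k) (m - k))
      + (\<Sum>k\<le>m. real (m choose k) * F (Suc k) (m - k))"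
    by (simp add: sum.distrib[symmetric] algebra_simps)
  finally show ?thesis using 1 by (simp add: sum.distrib distrib_left)
qed

text \<open>Leibniz rule. The step is
  \<open>fdiff (f * g) t = fdiff f t * g (t + 1) + f t * fdiff g t\<close>, so each difference that
  falls on \<open>f\<close> moves the argument of \<open>g\<close> one step ahead.\<close>

lemma fdiffs_mult:
  "fdiffs m (\<lambda>s. f s * g s) t = (\<Sum>k\<le>m. real (m choose k) * (fdiffs k f t * fdiffs (m - k) g (t + k)))"
proof (induction m arbitrary: t)
  case 0
  show ?case by simp
next
  case (Suc m)
  define F where "F k j = fdiffs k f t * fdiffs j g (t + k)" for k j
  have "fdiffs (Suc m) (\<lambda>s. f s * g s) t =
     (\<Sum>k\<le>m. real (m choose k) * (F (Suc k) (m - k) + F k (Suc (m - k))))"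
    unfolding fdiffs_Suc Suc F_def sum_subtractf[symmetric]
    by (intro sum.cong refl) (simp add: fdiff_def algebra_simps)
  then show ?case unfolding sum_Pascal[of m F] unfolding F_def .
qed

text \<open>
  The weights \<open>k! / R\<^sup>k\<close> alone are not closed under products. The factor \<open>1 / (k + 1)\<^sup>2\<close> makes them
  closed up to the constant 8, without any loss in the radius \<open>R\<close>.
\<close>

definition wt :: "real \<Rightarrow> nat \<Rightarrow> real" where
  "wt R k = fact k / (R ^ k * (real k + 1)\<^sup>2)"

lemma wt_pos: "R > 0 \<Longrightarrow> wt R k > 0"
  by (simp add: wt_def)

lemma sum_inverse_squares_le: "(\<Sum>k\<le>m. 1 / (real k + 1)\<^sup>2) \<le> 2 - 1 / (real m + 1)"
proof (induction m)
  case 0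
  show ?case by simp
next
  case (Suc m)
  define x where "x = real m + 1"
  have x: "x > 0" by (simp add: x_def)
  have "1 / (x + 1)\<^sup>2 \<le> 1 / (x * (x + 1))"
    using x by (intro divide_left_mono) (auto simp: power2_eq_square)
  also have "\<dots> = 1 / x - 1 / (x + 1)" using x by (simp add: field_simps)
  finally have "1 / (x + 1)\<^sup>2 \<le> 1 / x - 1 / (x + 1)" .
  then show ?case using Suc by (simp add: x_def algebra_simps)
qed

text \<open>One of the two indices is always at least of the order of \<open>m\<close>, so the
  convolution decays like a single factor. The 8 is a product of three factors 2: from
  \<open>(x + y)\<^sup>2 \<le> 2 * (x\<^sup>2 + y\<^sup>2)\<close>, from the two symmetric halves,
  and from the sum of the inverse squares.\<close>

lemma sum_convolution_inverse_squares_le: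
  "(\<Sum>k\<le>m. 1 / ((real k + 1)\<^sup>2 * (real (m - k) + 1)\<^sup>2)) \<le> 8 / (real m + 1)\<^sup>2"
proof -
  have le: "1 / ((real k + 1)\<^sup>2 * (real (m - k) + 1)\<^sup>2)
      \<le> 2 / (real m + 1)\<^sup>2 * (1 / (real k + 1)\<^sup>2 + 1 / (real (m - k) + 1)\<^sup>2)" if "k \<le> m" for k
  proof -
    define x y where "x = real k + 1" and "y = real (m - k) + 1"
    have xy: "x > 0" "y > 0" "real m + 1 \<le> x + y" using that by (auto simp: x_def y_def)
    have "(real m + 1)\<^sup>2 \<le> (x + y)\<^sup>2" using xy by (intro power_mono) auto
    also have "\<dots> \<le> 2 * (x\<^sup>2 + y\<^sup>2)"
      using zero_le_power2[of "x - y"] by (simp add: power2_eq_square algebra_simps)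
    finally have "(real m + 1)\<^sup>2 \<le> 2 * (x\<^sup>2 + y\<^sup>2)" .
    then have "1 / (x\<^sup>2 * y\<^sup>2) \<le> (2 * (x\<^sup>2 + y\<^sup>2)) / (real m + 1)\<^sup>2 * (1 / (x\<^sup>2 * y\<^sup>2))"
      using xy by (simp add: field_simps)
    also have "\<dots> = 2 / (real m + 1)\<^sup>2 * (1 / x\<^sup>2 + 1 / y\<^sup>2)"
      using xy by (simp add: field_simps)
    finally show ?thesis by (simp add: x_def y_def)
  qed
  have flip: "(\<Sum>k\<le>m. 1 / (real (m - k) + 1)\<^sup>2) = (\<Sum>k\<le>m. 1 / (real k + 1)\<^sup>2)"
    by (rule sum.reindex_bij_witness[of _ "\<lambda>k. m - k" "\<lambda>k. m - k"]) auto
  have "(\<Sum>k\<le>m. 1 / ((real k + 1)\<^sup>2 * (real (m - k) + 1)\<^sup>2)) \<le>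
     (\<Sum>k\<le>m. 2 / (real m + 1)\<^sup>2 * (1 / (real k + 1)\<^sup>2 + 1 / (real (m - k) + 1)\<^sup>2))"
    using le by (intro sum_mono) auto
  also have "\<dots> = 4 / (real m + 1)\<^sup>2 * (\<Sum>k\<le>m. 1 / (real k + 1)\<^sup>2)"
    unfolding sum_distrib_left[symmetric] sum.distrib flip by simp
  also have "\<dots> \<le> 4 / (real m + 1)\<^sup>2 * 2"
    using sum_inverse_squares_le[of m]
    by (intro mult_left_mono) (auto intro: order_trans)
  finally show ?thesis by simp
qed

lemma sum_choose_wt_le:
  assumes "R > 0"
  shows "(\<Sum>k\<le>m. real (m choose k) * (wt R k * wt R (m - k))) \<le> 8 * wt R m"
proof -
  have "real (m choose k) * (wt R k * wt R (m - k)) =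
     fact m / R ^ m * (1 / ((real k + 1)\<^sup>2 * (real (m - k) + 1)\<^sup>2))" if "k \<le> m" for k
  proof -
    have "fact k * fact (m - k) * real (m choose k) = fact m"
      using binomial_fact_lemma[OF that] by (metis of_nat_fact of_nat_mult)
    moreover have "R ^ m = R ^ k * R ^ (m - k)" using that by (simp flip: power_add)
    ultimately show ?thesis using assms by (simp add: wt_def field_simps)
  qed
  then have "(\<Sum>k\<le>m. real (m choose k) * (wt R k * wt R (m - k))) =
     fact m / R ^ m * (\<Sum>k\<le>m. 1 / ((real k + 1)\<^sup>2 * (real (m - k) + 1)\<^sup>2))"
    unfolding sum_distrib_left by (intro sum.cong) auto
  also have "\<dots> \<le> fact m / R ^ m * (8 / (real m + 1)\<^sup>2)"
    using assms by (intro mult_left_mono sum_convolution_inverse_squares_le) auto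
  also have "\<dots> = 8 * wt R m" by (simp add: wt_def)
  finally show ?thesis .
qed

text \<open>The factor 8 makes the norm submultiplicative.\<close>

definition window_norm :: "real \<Rightarrow> nat \<Rightarrow> (nat \<Rightarrow> real) \<Rightarrow> real" where
  "window_norm R h f = Max ((\<lambda>(k, s). 8 * \<bar>fdiffs k f s\<bar> / wt R k) ` {(k, s). k + s \<le> h})"

lemma finite_window: "finite {(k, s). k + s \<le> (h::nat)}"
  by (rule finite_subset[of _ "{..h} \<times> {..h}"]) auto

context
  fixes R :: real and h :: nat
  assumes R: "R > 0"
begin

lemma window_norm_le_iff:
  "window_norm R h f \<le> \<beta> \<longleftrightarrow> (\<forall>k s. k + s \<le> h \<longrightarrow> \<bar>fdiffs k f s\<bar> \<le> \<beta> / 8 * wt R k)"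
proof -
  have "{(k, s). k + s \<le> h} \<noteq> {}" by (auto intro!: exI[of _ 0])
  then have "window_norm R h f \<le> \<beta> \<longleftrightarrow> (\<forall>k s. k + s \<le> h \<longrightarrow> 8 * \<bar>fdiffs k f s\<bar> / wt R k \<le> \<beta>)"
    unfolding window_norm_def using finite_window[of h] by (subst Max_le_iff) auto
  then show ?thesis using wt_pos[OF R] by (simp add: field_simps)
qed

lemma window_normD: "k + s \<le> h \<Longrightarrow> \<bar>fdiffs k f s\<bar> \<le> window_norm R h f / 8 * wt R k"
  using window_norm_le_iff by blast

lemma window_norm_nonneg: "0 \<le> window_norm R h f"
proof -
  have "\<bar>fdiffs 0 f 0\<bar> \<le> window_norm R h f / 8 * wt R 0" by (rule window_normD) auto
  then have "0 \<le> window_norm R h f / 8 * wt R 0" by simp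
  then show ?thesis using wt_pos[OF R, of 0] by (simp add: zero_le_mult_iff)
qed

text \<open>The triangle \<open>k + s \<le> h\<close> consists of the differences that are computed
  from the values at \<open>0, ..., h\<close> alone, so the norm sees nothing outside this
  window.\<close>

lemma window_norm_cong:
  assumes "\<And>s. s \<le> h \<Longrightarrow> f s = g s"
  shows "window_norm R h f = window_norm R h g"
  unfolding window_norm_def using assms
  by (intro arg_cong[of _ _ Max] image_cong refl) (auto intro!: fdiffs_cong arg_cong[of _ _ abs])

lemma window_norm_add: "window_norm R h (\<lambda>s. f s + g s) \<le> window_norm R h f + window_norm R h g"
  unfolding window_norm_le_iff fdiffs_add
proof (intro allI impI)
  fix k s assume ks: "k + s \<le> h"
  show "\<bar>fdiffs k f s + fdiffs k g s\<bar> \<le> (window_norm R h f + window_norm R h g) / 8 * wt R k"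
    using window_normD[OF ks, of f] window_normD[OF ks, of g]
      abs_triangle_ineq[of "fdiffs k f s" "fdiffs k g s"]
    by (simp add: add_divide_distrib distrib_right)
qed

lemma window_norm_cmult_le: "window_norm R h (\<lambda>s. c * f s) \<le> \<bar>c\<bar> * window_norm R h f"
  unfolding window_norm_le_iff fdiffs_cmult
proof (intro allI impI)
  fix k s assume "k + s \<le> h"
  from mult_left_mono[OF window_normD[OF this, of f], of "\<bar>c\<bar>"]
  show "\<bar>c * fdiffs k f s\<bar> \<le> \<bar>c\<bar> * window_norm R h f / 8 * wt R k"
    by (simp add: abs_mult)
qed

lemma window_norm_average_le:
  assumes "finite A" "\<And>a. a \<in> A \<Longrightarrow> 0 \<le> p a" "(\<Sum>a\<in>A. p a) = 1"
    and "\<And>a. a \<in> A \<Longrightarrow> window_norm R h (f a) \<le> \<beta>"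
  shows "window_norm R h (\<lambda>s. \<Sum>a\<in>A. p a * f a s) \<le> \<beta>"
  unfolding window_norm_le_iff fdiffs_sum fdiffs_cmult
proof (intro allI impI)
  fix k s assume ks: "k + s \<le> h"
  have f: "\<bar>fdiffs k (f a) s\<bar> \<le> \<beta> / 8 * wt R k" if "a \<in> A" for a
    using assms(4)[OF that] ks window_norm_le_iff by blast
  have "\<bar>p a * fdiffs k (f a) s\<bar> \<le> p a * (\<beta> / 8 * wt R k)" if "a \<in> A" for a
    using mult_left_mono[OF f[OF that] assms(2)[OF that]] assms(2)[OF that] by (simp only: abs_mult abs_of_nonneg)
  then have "\<bar>\<Sum>a\<in>A. p a * fdiffs k (f a) s\<bar> \<le> (\<Sum>a\<in>A. p a * (\<beta> / 8 * wt R k))"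
    by (intro order_trans[OF sum_abs] sum_mono)
  then show "\<bar>\<Sum>a\<in>A. p a * fdiffs k (f a) s\<bar> \<le> \<beta> / 8 * wt R k"
    unfolding sum_distrib_right[symmetric] assms(3) by simp
qed

lemma window_norm_mult: "window_norm R h (\<lambda>s. f s * g s) \<le> window_norm R h f * window_norm R h g"
  unfolding window_norm_le_iff
proof (intro allI impI)
  fix m s assume ms: "m + s \<le> h"
  let ?F = "window_norm R h f" and ?G = "window_norm R h g"
  have "\<bar>fdiffs m (\<lambda>s. f s * g s) s\<bar> \<le>
    (\<Sum>k\<le>m. real (m choose k) * ((?F / 8 * wt R k) * (?G / 8 * wt R (m - k))))"
    unfolding fdiffs_mult
  proof (intro order_trans[OF sum_abs] sum_mono)
    fix k assume "k \<in> {..m}"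
    then have k: "k \<le> m" by simp
    \<comment> \<open>The shift in the Leibniz rule stays inside the triangle, since
      \<open>(m - k) + (s + k) = m + s\<close>.\<close>
    have "\<bar>fdiffs k f s * fdiffs (m - k) g (s + k)\<bar> \<le> (?F / 8 * wt R k) * (?G / 8 * wt R (m - k))"
      unfolding abs_mult using ms k window_norm_nonneg wt_pos[OF R]
      by (intro mult_mono window_normD) (auto simp: less_imp_le)
    then show "\<bar>real (m choose k) * (fdiffs k f s * fdiffs (m - k) g (s + k))\<bar> \<le>
        real (m choose k) * ((?F / 8 * wt R k) * (?G / 8 * wt R (m - k)))"
      unfolding abs_mult[of "real _"] abs_of_nat by (rule mult_left_mono) simp
  qed
  also have "\<dots> = ?F * ?G / 64 * (\<Sum>k\<le>m. real (m choose k) * (wt R k * wt R (m - k)))"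
    unfolding sum_distrib_left by (intro sum.cong) auto
  also have "\<dots> \<le> ?F * ?G / 64 * (8 * wt R m)"
    using window_norm_nonneg by (intro mult_left_mono sum_choose_wt_le R) auto
  finally show "\<bar>fdiffs m (\<lambda>s. f s * g s) s\<bar> \<le> ?F * ?G / 8 * wt R m"
    by (simp add: mult.commute)
qed

text \<open>The empty product is excluded because the constant 1 has norm 8. For the same reason the
  bounds on powers, exponentials and inverses below measure the distance from 1.\<close>

lemma window_norm_prod:
  assumes "finite S" "S \<noteq> {}" "\<And>j. j \<in> S \<Longrightarrow> window_norm R h (f j) \<le> \<beta>" "\<beta> \<ge> 0"
  shows "window_norm R h (\<lambda>s. \<Prod>j\<in>S. f j s) \<le> \<beta> ^ card S"
  using assms(1-3)
proof (induction S rule: finite_ne_induct)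
  case (singleton j)
  then show ?case by simp
next
  case (insert j S)
  have "window_norm R h (\<lambda>s. \<Prod>i\<in>insert j S. f i s) = window_norm R h (\<lambda>s. f j s * (\<Prod>i\<in>S. f i s))"
    using insert by simp
  also have "\<dots> \<le> window_norm R h (f j) * window_norm R h (\<lambda>s. \<Prod>i\<in>S. f i s)"
    by (rule window_norm_mult)
  also have "\<dots> \<le> \<beta> * \<beta> ^ card S"
    using insert assms(4) window_norm_nonneg by (intro mult_mono) auto
  finally show ?case using insert by simp
qed

lemma window_norm_lim:
  assumes "\<And>s. (\<lambda>m. f m s) \<longlonglongrightarrow> g s" "\<And>m. window_norm R h (f m) \<le> \<beta>"
  shows "window_norm R h g \<le> \<beta>"
  unfolding window_norm_le_iff
proof (intro allI impI)
  fix k s assume ks: "k + s \<le> h"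
  obtain c where c: "\<And>f t. fdiffs k f t = (\<Sum>s\<le>k. c s * f (t + s))" using fdiffs_coeffs by blast
  have "(\<lambda>m. \<bar>fdiffs k (f m) s\<bar>) \<longlonglongrightarrow> \<bar>fdiffs k g s\<bar>"
    unfolding c by (intro tendsto_intros assms)
  moreover have "\<bar>fdiffs k (f m) s\<bar> \<le> \<beta> / 8 * wt R k" for m
    using assms(2) ks window_norm_le_iff by blast
  ultimately show "\<bar>fdiffs k g s\<bar> \<le> \<beta> / 8 * wt R k"
    by (meson LIMSEQ_le_const2)
qed

section \<open>Exponentials, inverses and Gibbs ratios in the window norm\<close>

lemma window_norm_power_minus_one:
  assumes "window_norm R h f \<le> \<beta>"
  shows "window_norm R h (\<lambda>s. (1 + f s) ^ m - 1) \<le> (1 + \<beta>) ^ m - 1"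
proof (induction m)
  case 0
  have "window_norm R h (\<lambda>s. 0 * f s) \<le> \<bar>0\<bar> * window_norm R h f" by (rule window_norm_cmult_le)
  then show ?case by simp
next
  case (Suc m)
  let ?g = "\<lambda>s. (1 + f s) ^ m - 1"
  have \<beta>: "\<beta> \<ge> 0" using assms window_norm_nonneg order_trans by blast
  have "window_norm R h (\<lambda>s. (1 + f s) ^ Suc m - 1) = window_norm R h (\<lambda>s. f s + (?g s + f s * ?g s))"
    by (intro window_norm_cong) (simp add: algebra_simps)
  also have "\<dots> \<le> window_norm R h f + (window_norm R h ?g + window_norm R h f * window_norm R h ?g)"
    by (intro order_trans[OF window_norm_add] add_mono order_refl window_norm_mult)
  also have "\<dots> \<le> \<beta> + (((1 + \<beta>) ^ m - 1) + \<beta> * ((1 + \<beta>) ^ m - 1))"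
    using assms Suc \<beta> window_norm_nonneg by (intro add_mono mult_mono) auto
  also have "\<dots> = (1 + \<beta>) ^ Suc m - 1" by (simp add: algebra_simps)
  finally show ?case .
qed

text \<open>Writing \<open>exp\<close> as the limit of \<open>(1 + f / m) ^ m\<close> replaces a
  chain rule for finite differences by submultiplicativity.\<close>

lemma window_norm_exp_minus_one:
  assumes "window_norm R h f \<le> \<beta>"
  shows "window_norm R h (\<lambda>s. exp (f s) - 1) \<le> exp \<beta> - 1"
proof (rule window_norm_lim)
  show "(\<lambda>m. (1 + f s / real m) ^ m - 1) \<longlonglongrightarrow> exp (f s) - 1" for s
    by (intro tendsto_intros tendsto_exp_limit_sequentially)
  have \<beta>: "\<beta> \<ge> 0" using assms window_norm_nonneg order_trans by blast
  fix m :: nat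
  have "window_norm R h (\<lambda>s. f s / real m) \<le> \<beta> / real m"
    using order_trans[OF window_norm_cmult_le[of "1 / real m" f], of "\<beta> / real m"] assms
    by (simp add: divide_right_mono)
  then have "window_norm R h (\<lambda>s. (1 + f s / real m) ^ m - 1) \<le> (1 + \<beta> / real m) ^ m - 1"
    by (rule window_norm_power_minus_one)
  also have "(1 + \<beta> / real m) ^ m \<le> exp \<beta>"
    using \<beta> by (cases "m = 0") (auto intro!: exp_ge_one_plus_x_over_n_power_n)
  finally show "window_norm R h (\<lambda>s. (1 + f s / real m) ^ m - 1) \<le> exp \<beta> - 1" by simp
qed

text \<open>With \<open>v = z - 1\<close> and \<open>w = inverse z - 1\<close> one has
  \<open>w = - (v + v * w)\<close>. The norm of \<open>w\<close> is finite beforehand, so the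
  resulting inequality can be solved for it without a Neumann series.\<close>

lemma window_norm_inverse_minus_one:
  assumes "window_norm R h (\<lambda>s. z s - 1) \<le> \<beta>" "\<beta> < 1" "\<And>s. z s \<noteq> 0"
  shows "window_norm R h (\<lambda>s. inverse (z s) - 1) \<le> \<beta> / (1 - \<beta>)"
proof -
  let ?v = "\<lambda>s. z s - 1" and ?w = "\<lambda>s. inverse (z s) - 1"
  have "window_norm R h ?w = window_norm R h (\<lambda>s. (-1) * (?v s + ?v s * ?w s))"
    using assms(3) by (intro window_norm_cong) (simp add: field_simps)
  also have "\<dots> \<le> \<bar>-1\<bar> * window_norm R h (\<lambda>s. ?v s + ?v s * ?w s)"
    by (rule window_norm_cmult_le)
  also have "\<dots> \<le> window_norm R h ?v + window_norm R h ?v * window_norm R h ?w"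
    using order_trans[OF window_norm_add add_left_mono[OF window_norm_mult]] by simp
  also have "\<dots> \<le> \<beta> + \<beta> * window_norm R h ?w"
    using assms(1) window_norm_nonneg by (intro add_mono mult_right_mono) auto
  finally show ?thesis using assms(2) by (simp add: field_simps)
qed

text \<open>The likelihood ratio of a Gibbs measure with respect to the reference measure \<open>p\<close>.\<close>

lemma window_norm_softmax_ratio:
  assumes "finite A" "\<And>a. a \<in> A \<Longrightarrow> 0 \<le> p a" "(\<Sum>a\<in>A. p a) = 1"
    and f: "\<And>a. a \<in> A \<Longrightarrow> window_norm R h (f a) \<le> \<beta>" and \<beta>: "\<beta> \<le> 1 / 8"
    and "a \<in> A"
  shows "window_norm R h (\<lambda>s. exp (f a s) / (\<Sum>b\<in>A. p b * exp (f b s)) - 1) \<le> 8 * \<beta>"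
proof -
  define Z where "Z s = (\<Sum>b\<in>A. p b * exp (f b s))" for s
  have \<beta>0: "\<beta> \<ge> 0" using f[OF assms(6)] window_norm_nonneg order_trans by blast
  have "exp \<beta> \<le> 1 + \<beta> + \<beta>\<^sup>2" using \<beta> \<beta>0 by (intro exp_bound) auto
  also have "\<beta>\<^sup>2 \<le> \<beta> * (1 / 8)" unfolding power2_eq_square using \<beta> \<beta>0 by (intro mult_left_mono)
  finally have "exp \<beta> - 1 \<le> 2 * \<beta>" using \<beta>0 by simp
  then have E: "window_norm R h (\<lambda>s. exp (f b s) - 1) \<le> 2 * \<beta>" if "b \<in> A" for b
    using window_norm_exp_minus_one[OF f[OF that]] by linarith
  have "Z s - 1 = (\<Sum>b\<in>A. p b * (exp (f b s) - 1))" for s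
    unfolding Z_def right_diff_distrib sum_subtractf using assms(3) by simp
  then have Z: "window_norm R h (\<lambda>s. Z s - 1) \<le> 2 * \<beta>"
    using window_norm_average_le[of A p "\<lambda>b s. exp (f b s) - 1" "2 * \<beta>"] assms(1-3) E by simp
  have "Z s \<noteq> 0" for s
  proof -
    obtain b where "b \<in> A" "p b \<noteq> 0" using assms(3) by (metis sum.neutral zero_neq_one)
    then have "p b > 0" using assms(2) by (metis le_less)
    then have "0 < (\<Sum>b\<in>A. p b * exp (f b s))"
      using assms(1,2) \<open>b \<in> A\<close> by (intro sum_pos2[of _ b]) auto
    then show ?thesis by (simp add: Z_def)
  qed
  then have "window_norm R h (\<lambda>s. inverse (Z s) - 1) \<le> 2 * \<beta> / (1 - 2 * \<beta>)"
    using Z \<beta> by (intro window_norm_inverse_minus_one) auto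
  also have "\<dots> \<le> 4 * \<beta>"
  proof -
    have "2 * \<beta> * 1 \<le> 2 * \<beta> * (2 * (1 - 2 * \<beta>))" using \<beta> \<beta>0 by (intro mult_left_mono) auto
    then have "2 * \<beta> \<le> 4 * \<beta> * (1 - 2 * \<beta>)" by (simp add: algebra_simps)
    then show ?thesis using \<beta> by (subst pos_divide_le_eq) auto
  qed
  finally have W: "window_norm R h (\<lambda>s. inverse (Z s) - 1) \<le> 4 * \<beta>" .
  let ?e = "\<lambda>s. exp (f a s) - 1" and ?w = "\<lambda>s. inverse (Z s) - 1"
  \<comment> \<open>A product of two perturbations of 1:
    \<open>(1 + e) * (1 + w) - 1 = e + w + e * w\<close>.\<close>
  have "window_norm R h (\<lambda>s. exp (f a s) / Z s - 1) = window_norm R h (\<lambda>s. ?e s + (?w s + ?e s * ?w s))"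
    by (intro window_norm_cong) (simp add: algebra_simps divide_inverse)
  also have "\<dots> \<le> window_norm R h ?e + (window_norm R h ?w + window_norm R h ?e * window_norm R h ?w)"
    by (intro order_trans[OF window_norm_add] add_mono order_refl window_norm_mult)
  also have "\<dots> \<le> 2 * \<beta> + (4 * \<beta> + 2 * \<beta> * (4 * \<beta>))"
    using E[OF assms(6)] W \<beta>0 window_norm_nonneg by (intro add_mono mult_mono) auto
  also have "\<dots> \<le> 8 * \<beta>"
  proof -
    have "\<beta> * (8 * \<beta>) \<le> \<beta> * 1" using \<beta> \<beta>0 by (intro mult_left_mono) auto
    then show ?thesis using \<beta>0 by simp
  qed
  finally show ?thesis by (simp add: Z_def)
qed

end

section \<open>Discrete interpolation between differences\<close>

definition energy :: "(nat \<Rightarrow> real) \<Rightarrow> nat \<Rightarrow> nat \<Rightarrow> (nat \<Rightarrow> real) \<Rightarrow> real" where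
  "energy w p q f = (\<Sum>t\<in>{p..<q}. w t * (f t)\<^sup>2)"

lemma abs_mult_le_weighted_squares:
  fixes x y :: real
  assumes "\<alpha> > 0"
  shows "\<bar>x * y\<bar> \<le> \<alpha> / 2 * x\<^sup>2 + 1 / (2 * \<alpha>) * y\<^sup>2"
proof -
  have "0 \<le> (\<alpha> * \<bar>x\<bar> - \<bar>y\<bar>)\<^sup>2 / (2 * \<alpha>)" using assms by simp
  also have "\<dots> = \<alpha> / 2 * x\<^sup>2 + 1 / (2 * \<alpha>) * y\<^sup>2 - \<bar>x * y\<bar>"
    using assms by (simp add: power2_eq_square field_simps abs_mult abs_mult_self_eq)
  finally show ?thesis by simp
qed

text \<open>Summation by parts leaves \<open>f\<close> against \<open>fdiff (fdiff f)\<close> and,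
  because the weights vary, \<open>f\<close> against \<open>fdiff f\<close> with a factor of size
  \<open>\<kappa>\<close>. Both products are split into squares with free parameters
  \<open>\<alpha>\<close> and \<open>\<beta>\<close>. The squares of \<open>f\<close> sit at
  \<open>Suc t\<close>, those of its differences at \<open>t\<close>; hence the two forms of the
  hypothesis on \<open>w\<close>.\<close>

lemma energy_fdiff_le:
  assumes "p \<le> q" and w: "\<And>t. w t \<ge> 0"
    and w1: "\<And>t. \<bar>w (Suc t) - w t\<bar> \<le> \<kappa> * w t"
    and w2: "\<And>t. \<bar>w (Suc t) - w t\<bar> \<le> \<kappa> * w (Suc t)"
    and "\<kappa> \<ge> 0" "\<alpha> > 0" "\<beta> > 0"
  shows "energy w p q (fdiff f) \<le> \<bar>w p * f p * fdiff f p\<bar> + \<bar>w q * f q * fdiff f q\<bar>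
     + (\<alpha> / 2 + \<kappa> * \<beta> / 2) * (energy w p q f + w q * (f q)\<^sup>2)
     + (1 + \<kappa>) / (2 * \<alpha>) * energy w p q (fdiff (fdiff f))
     + \<kappa> / (2 * \<beta>) * energy w p q (fdiff f)"
proof -
  define h where "h t = w t * f t * fdiff f t" for t
  have parts: "w t * (fdiff f t)\<^sup>2 = (h (Suc t) - h t)
      - f (Suc t) * (w (Suc t) * fdiff (fdiff f) t) - f (Suc t) * ((w (Suc t) - w t) * fdiff f t)" for t
    unfolding h_def fdiff_def by (simp add: power2_eq_square algebra_simps)
  have le: "w t * (fdiff f t)\<^sup>2 \<le> (h (Suc t) - h t)
      + (\<alpha> / 2 + \<kappa> * \<beta> / 2) * (w (Suc t) * (f (Suc t))\<^sup>2)
      + (1 + \<kappa>) / (2 * \<alpha>) * (w t * (fdiff (fdiff f) t)\<^sup>2)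
      + \<kappa> / (2 * \<beta>) * (w t * (fdiff f t)\<^sup>2)" for t
  proof -
    let ?u = "w t" and ?v = "w (Suc t)" and ?x = "f (Suc t)"
      and ?y = "fdiff f t" and ?z = "fdiff (fdiff f) t"
    have "- (?x * (?v * ?z)) \<le> ?v * \<bar>?x * ?z\<bar>"
      using w[of "Suc t"] by (metis abs_ge_minus_self abs_mult abs_of_nonneg mult.left_commute)
    also have "\<dots> \<le> ?v * (\<alpha> / 2 * ?x\<^sup>2 + 1 / (2 * \<alpha>) * ?z\<^sup>2)"
      using w assms by (intro mult_left_mono abs_mult_le_weighted_squares) auto
    also have "\<dots> = \<alpha> / 2 * (?v * ?x\<^sup>2) + ?v * (1 / (2 * \<alpha>) * ?z\<^sup>2)" by (simp add: algebra_simps)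
    also have "?v * (1 / (2 * \<alpha>) * ?z\<^sup>2) \<le> ((1 + \<kappa>) * ?u) * (1 / (2 * \<alpha>) * ?z\<^sup>2)"
      using abs_le_D1[OF w1[of t]] assms by (intro mult_right_mono) (auto simp: algebra_simps)
    finally have A: "- (?x * (?v * ?z)) \<le> \<alpha> / 2 * (?v * ?x\<^sup>2) + (1 + \<kappa>) / (2 * \<alpha>) * (?u * ?z\<^sup>2)"
      by (simp add: algebra_simps)
    have "- (?x * ((?v - ?u) * ?y)) \<le> \<bar>?v - ?u\<bar> * \<bar>?x * ?y\<bar>"
      by (metis abs_ge_minus_self abs_mult mult.left_commute)
    also have "\<dots> \<le> \<bar>?v - ?u\<bar> * (\<beta> / 2 * ?x\<^sup>2 + 1 / (2 * \<beta>) * ?y\<^sup>2)"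
      using assms by (intro mult_left_mono abs_mult_le_weighted_squares) auto
    also have "\<dots> = \<bar>?v - ?u\<bar> * (\<beta> / 2 * ?x\<^sup>2) + \<bar>?v - ?u\<bar> * (1 / (2 * \<beta>) * ?y\<^sup>2)"
      by (simp add: algebra_simps)
    also have "\<dots> \<le> (\<kappa> * ?v) * (\<beta> / 2 * ?x\<^sup>2) + (\<kappa> * ?u) * (1 / (2 * \<beta>) * ?y\<^sup>2)"
      using assms by (intro add_mono mult_right_mono w1 w2) auto
    finally have B: "- (?x * ((?v - ?u) * ?y)) \<le>
      \<kappa> * \<beta> / 2 * (?v * ?x\<^sup>2) + \<kappa> / (2 * \<beta>) * (?u * ?y\<^sup>2)" by (simp add: algebra_simps)
    show ?thesis using parts[of t] A B by (subst distrib_right) linarith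
  qed
  have shift: "(\<Sum>t\<in>{p..<q}. w (Suc t) * (f (Suc t))\<^sup>2) \<le> energy w p q f + w q * (f q)\<^sup>2"
  proof -
    have "(\<Sum>t\<in>{p..<q}. w (Suc t) * (f (Suc t))\<^sup>2) = (\<Sum>t\<in>{Suc p..<Suc q}. w t * (f t)\<^sup>2)"
      by (rule sum.shift_bounds_Suc_ivl[symmetric])
    also have "\<dots> \<le> (\<Sum>t\<in>{p..<Suc q}. w t * (f t)\<^sup>2)"
      using w by (intro sum_mono2) auto
    finally show ?thesis using assms(1) by (simp add: energy_def)
  qed
  have tele: "(\<Sum>t\<in>{p..<q}. h (Suc t) - h t) = h q - h p"
    using assms(1) by (rule sum_Suc_diff')
  have "energy w p q (fdiff f) \<le> (h q - h p)
      + (\<alpha> / 2 + \<kappa> * \<beta> / 2) * (\<Sum>t\<in>{p..<q}. w (Suc t) * (f (Suc t))\<^sup>2)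
      + (1 + \<kappa>) / (2 * \<alpha>) * energy w p q (fdiff (fdiff f))
      + \<kappa> / (2 * \<beta>) * energy w p q (fdiff f)"
    unfolding energy_def tele[symmetric] sum_distrib_left sum.distrib[symmetric]
    by (intro sum_mono le)
  also have "(\<alpha> / 2 + \<kappa> * \<beta> / 2) * (\<Sum>t\<in>{p..<q}. w (Suc t) * (f (Suc t))\<^sup>2)
    \<le> (\<alpha> / 2 + \<kappa> * \<beta> / 2) * (energy w p q f + w q * (f q)\<^sup>2)"
    using assms by (intro mult_left_mono shift) auto
  finally show ?thesis unfolding h_def by linarith
qed

text \<open>
  If the second difference is controlled by the first with ratio \<open>r\<close>, then the first is controlled
  by the function itself with a ratio that is only slightly larger: discrete log-convexity.
\<close>

lemma energy_ratio_step:
  assumes "p \<le> q" "\<And>t. w t \<ge> 0"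
    and "\<And>t. \<bar>w (Suc t) - w t\<bar> \<le> \<kappa> * w t" "\<And>t. \<bar>w (Suc t) - w t\<bar> \<le> \<kappa> * w (Suc t)"
    and "\<kappa> \<ge> 0" "r > 0"
    and r': "r' = (1 + \<kappa>) * r + \<kappa>"
    and E2: "energy w p q (fdiff (fdiff f)) \<le> r\<^sup>2 * energy w p q (fdiff f) + X" and "X \<ge> 0"
    and M: "\<bar>f p\<bar> \<le> M" "\<bar>f q\<bar> \<le> M" "\<bar>fdiff f p\<bar> \<le> M" "\<bar>fdiff f q\<bar> \<le> M"
    and r'1: "r' \<le> 1"
  shows "energy w p q (fdiff f) \<le> r'\<^sup>2 * energy w p q f + 3 * M\<^sup>2 * (w p + w q) + X / r\<^sup>2"
proof -
  have "r \<le> r'" "(1 + \<kappa>) * r \<le> r'" using assms by (auto simp: algebra_simps)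
  then have rr: "r \<le> r'" "r' > 0" "(1 + \<kappa>) * r \<le> r'" using \<open>r > 0\<close> by auto
  let ?E0 = "energy w p q f" and ?E1 = "energy w p q (fdiff f)" and ?E2 = "energy w p q (fdiff (fdiff f))"
  have E: "?E0 \<ge> 0" "?E1 \<ge> 0" using assms(2) by (auto simp: energy_def intro!: sum_nonneg)
  have bd: "\<bar>w s * f s * fdiff f s\<bar> \<le> M\<^sup>2 * w s" if "\<bar>f s\<bar> \<le> M" "\<bar>fdiff f s\<bar> \<le> M" for s
  proof -
    have "w s * (\<bar>f s\<bar> * \<bar>fdiff f s\<bar>) \<le> w s * (M * M)"
      using that assms(2) by (intro mult_left_mono mult_mono) auto
    then show ?thesis using assms(2)[of s] by (simp add: abs_mult power2_eq_square mult.commute mult.left_commute)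
  qed
  have fq: "w q * (f q)\<^sup>2 \<le> M\<^sup>2 * w q"
    using mult_left_mono[OF power_mono[OF M(2), of 2] assms(2)[of q]] by (simp add: mult.commute)
  \<comment> \<open>With \<open>\<alpha> = r' * r\<close> and \<open>\<beta> = r'\<close> the
    coefficient of \<open>?E0\<close> is \<open>r' * (r + \<kappa>) / 2\<close>, at most
    \<open>r'\<^sup>2 / 2\<close>. Once the bound on \<open>?E2\<close> is inserted, that of
    \<open>?E1\<close> is \<open>((1 + \<kappa>) * r + \<kappa>) / (2 * r')\<close>, which is
    exactly 1/2 by the choice of \<open>r'\<close>; so half of \<open>?E1\<close> is absorbed on the
    left.\<close>
  have "?E1 \<le> M\<^sup>2 * w p + M\<^sup>2 * w q
     + (r' * r / 2 + \<kappa> * r' / 2) * (?E0 + w q * (f q)\<^sup>2)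
     + (1 + \<kappa>) / (2 * (r' * r)) * ?E2 + \<kappa> / (2 * r') * ?E1"
    using energy_fdiff_le[of p q w \<kappa> "r' * r" r' f] bd[of p] bd[of q] M assms rr by fastforce
  also have "(r' * r / 2 + \<kappa> * r' / 2) * (?E0 + w q * (f q)\<^sup>2) \<le> r'\<^sup>2 / 2 * (?E0 + M\<^sup>2 * w q)"
  proof (rule mult_mono)
    show "?E0 + w q * (f q)\<^sup>2 \<le> ?E0 + M\<^sup>2 * w q" using fq by simp
    have "r + \<kappa> \<le> r'" using assms rr by (simp add: algebra_simps)
    then have "r' * (r + \<kappa>) \<le> r' * r'" using rr by (intro mult_left_mono) auto
    then show "r' * r / 2 + \<kappa> * r' / 2 \<le> r'\<^sup>2 / 2" by (simp add: power2_eq_square algebra_simps)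
  qed (use E assms(2) in auto)
  also have "(1 + \<kappa>) / (2 * (r' * r)) * ?E2 \<le> (1 + \<kappa>) / (2 * (r' * r)) * (r\<^sup>2 * ?E1 + X)"
    using assms rr by (intro mult_left_mono E2) auto
  also have "\<dots> = (1 + \<kappa>) * r / (2 * r') * ?E1 + (1 + \<kappa>) / (2 * (r' * r)) * X"
    using \<open>r > 0\<close> rr(2) by (simp add: field_simps power2_eq_square)
  also have "(1 + \<kappa>) / (2 * (r' * r)) * X \<le> X / r\<^sup>2 / 2"
  proof -
    have "((1 + \<kappa>) * r) / (2 * (r' * r\<^sup>2)) \<le> r' / (2 * (r' * r\<^sup>2))"
      using rr by (intro divide_right_mono) auto
    then have "(1 + \<kappa>) / (2 * (r' * r)) \<le> 1 / (2 * r\<^sup>2)"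
      using rr assms(6) by (simp add: power2_eq_square)
    from mult_right_mono[OF this \<open>X \<ge> 0\<close>] show ?thesis by simp
  qed
  finally have "?E1 \<le> M\<^sup>2 * w p + M\<^sup>2 * w q + r'\<^sup>2 / 2 * (?E0 + M\<^sup>2 * w q)
      + ((1 + \<kappa>) * r / (2 * r') * ?E1 + X / r\<^sup>2 / 2) + \<kappa> / (2 * r') * ?E1" by simp
  also have "\<dots> = M\<^sup>2 * w p + M\<^sup>2 * w q + r'\<^sup>2 / 2 * (?E0 + M\<^sup>2 * w q) + X / r\<^sup>2 / 2
      + ((1 + \<kappa>) * r + \<kappa>) / (2 * r') * ?E1"
    by (simp add: add_divide_distrib algebra_simps)
  also have "((1 + \<kappa>) * r + \<kappa>) / (2 * r') = 1 / 2" using rr by (simp add: r'[symmetric])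
  finally have "?E1 \<le> r'\<^sup>2 * ?E0 + 2 * (M\<^sup>2 * w p + M\<^sup>2 * w q) + r'\<^sup>2 * (M\<^sup>2 * w q) + X / r\<^sup>2"
    by (simp add: algebra_simps)
  moreover have "r'\<^sup>2 * (M\<^sup>2 * w q) \<le> 1 * (M\<^sup>2 * w q)"
    using rr r'1 assms(2) by (intro mult_right_mono power_le_one) auto
  moreover have "0 \<le> M\<^sup>2 * w p" using assms(2) by simp
  ultimately show ?thesis by (simp add: algebra_simps)
qed

text \<open>Downward induction on the order, each step being \<open>energy_ratio_step\<close>. At
  the top no ratio is known, but the energy itself is tiny, so the ratio bound holds there up to an
  additive error. At order 0 the ratio is at most \<open>(1 / 2)\<^sup>2\<close>, which is the
  quarter in the conclusion.\<close>

lemma energy_fdiff_le_energy: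
  assumes pq: "p \<le> q" and w: "\<And>t. w t \<ge> 0"
    and w': "\<And>t. \<bar>w (Suc t) - w t\<bar> \<le> \<kappa> * w t" "\<And>t. \<bar>w (Suc t) - w t\<bar> \<le> \<kappa> * w (Suc t)"
    and \<kappa>: "\<kappa> \<ge> 0" and \<delta>: "0 < \<delta>" "4 * \<delta> \<le> 1"
    and r1: "(1 + \<kappa>) ^ H * (1 + 4 * \<delta>) - 1 \<le> 1 / 2" and "H > 0"
    and g: "\<And>k t. k \<le> H \<Longrightarrow> p \<le> t \<Longrightarrow> \<bar>fdiffs k g t\<bar> \<le> 2 * \<delta> ^ k"
  shows "energy w p q (fdiff g) \<le> energy w p q g / 4 + 16 * (w p + w q) + 4 / 16 ^ H * (\<Sum>t\<in>{p..<q}. w t)"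
proof -
  \<comment> \<open>Four times the decay rate \<open>\<delta>\<close> of the differences:
    \<open>\<delta> ^ (2 * H)\<close> is smaller than \<open>\<rho> ^ (2 * H)\<close> by the factor
    \<open>16 ^ H\<close>, which will outweigh the number of rounds.\<close>
  define \<rho> where "\<rho> = 4 * \<delta>"
  \<comment> \<open>The solution of \<open>1 + r k = (1 + \<kappa>) * (1 + r (Suc k))\<close>, which
    is the recursion of \<open>energy_ratio_step\<close>, with the value \<open>\<rho>\<close> at
    \<open>k = H\<close>.\<close>
  define r where "r k = (1 + \<kappa>) ^ (H - k) * (1 + \<rho>) - 1" for k
  define E where "E k = energy w p q (fdiffs k g)" for k
  define X where "X = 4 * \<rho>\<^sup>2 / 16 ^ H * (\<Sum>t\<in>{p..<q}. w t)"
  define W where "W = w p + w q"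
  have \<rho>: "\<rho> > 0" "\<rho> \<le> 1" using \<delta> by (auto simp: \<rho>_def)
  have nn: "X \<ge> 0" "W \<ge> 0" using w by (auto simp: X_def W_def intro!: sum_nonneg mult_nonneg_nonneg divide_nonneg_pos)
  have r_ge: "r k \<ge> \<rho>" for k
  proof -
    have "1 * (1 + \<rho>) \<le> (1 + \<kappa>) ^ (H - k) * (1 + \<rho>)" using \<kappa> \<rho> by (intro mult_right_mono) auto
    then show ?thesis by (simp add: r_def)
  qed
  have r_le: "r k \<le> 1 / 2" for k
  proof -
    have "(1 + \<kappa>) ^ (H - k) * (1 + \<rho>) \<le> (1 + \<kappa>) ^ H * (1 + \<rho>)"
      using \<kappa> \<rho> by (intro mult_right_mono power_increasing) auto
    then show ?thesis using r1 by (simp add: r_def \<rho>_def)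
  qed
  have \<delta>2: "(\<delta> ^ k)\<^sup>2 = \<rho> ^ (2 * k) / 16 ^ k" for k
  proof -
    have "(\<delta> ^ k)\<^sup>2 = (\<delta>\<^sup>2) ^ k" by (simp add: power_mult[symmetric] mult.commute)
    also have "\<delta>\<^sup>2 = \<rho>\<^sup>2 / 16" by (simp add: \<rho>_def power2_eq_square)
    finally show ?thesis by (simp add: power_divide power_mult)
  qed
  have "E (Suc k) \<le> (r (Suc k))\<^sup>2 * E k + \<rho> ^ (2 * k) * (X + 16 * W / 16 ^ k)" if "k \<le> H - 1" for k
    using that
  proof (induction k rule: inc_induct)
    case base
    have "E H \<le> (\<Sum>t\<in>{p..<q}. w t * (4 * (\<delta> ^ H)\<^sup>2))"
      unfolding E_def energy_def
    proof (intro sum_mono mult_left_mono w)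
      fix t assume "t \<in> {p..<q}"
      then have "\<bar>fdiffs H g t\<bar> ^ 2 \<le> (2 * \<delta> ^ H)\<^sup>2" by (intro power_mono g) auto
      then show "(fdiffs H g t)\<^sup>2 \<le> 4 * (\<delta> ^ H)\<^sup>2" by (simp add: power_mult_distrib)
    qed
    also have "\<dots> = \<rho> ^ (2 * (H - 1)) * X"
    proof -
      have "\<rho> ^ (2 * H) = \<rho> ^ (2 * (H - 1)) * \<rho>\<^sup>2" using \<open>H > 0\<close>
        by (cases H) (simp_all add: power2_eq_square)
      then show ?thesis unfolding \<delta>2 X_def sum_distrib_right[symmetric] by (simp add: mult_ac)
    qed
    also have "\<dots> \<le> (r H)\<^sup>2 * E (H - 1) + \<rho> ^ (2 * (H - 1)) * (X + 16 * W / 16 ^ (H - 1))"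
    proof -
      have "0 \<le> (r H)\<^sup>2 * E (H - 1)" using w by (auto simp: E_def energy_def intro!: sum_nonneg mult_nonneg_nonneg)
      moreover have "\<rho> ^ (2 * (H - 1)) * X \<le> \<rho> ^ (2 * (H - 1)) * (X + 16 * W / 16 ^ (H - 1))"
        using nn \<rho> by (intro mult_left_mono) auto
      ultimately show ?thesis by linarith
    qed
    finally show ?case using \<open>H > 0\<close> by simp
  next
    case (step k)
    then have kH: "Suc (Suc k) \<le> H" by simp
    let ?X = "\<rho> ^ (2 * Suc k) * (X + 16 * W / 16 ^ Suc k)"
    have rS: "r (Suc k) = (1 + \<kappa>) * r (Suc (Suc k)) + \<kappa>"
    proof -
      have "H - Suc k = Suc (H - Suc (Suc k))" using kH by simp
      then show ?thesis by (simp add: r_def algebra_simps)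
    qed
    have bd: "\<bar>fdiffs k g t\<bar> \<le> 2 * \<delta> ^ k" "\<bar>fdiff (fdiffs k g) t\<bar> \<le> 2 * \<delta> ^ k" if "t \<ge> p" for t
    proof -
      show "\<bar>fdiffs k g t\<bar> \<le> 2 * \<delta> ^ k" using g kH that by simp
      have "\<bar>fdiffs (Suc k) g t\<bar> \<le> 2 * \<delta> ^ Suc k" using g kH that by (intro g) auto
      also have "\<dots> \<le> 2 * \<delta> ^ k" using \<delta> by (intro mult_left_mono power_decreasing) auto
      finally show "\<bar>fdiff (fdiffs k g) t\<bar> \<le> 2 * \<delta> ^ k" by simp
    qed
    have "energy w p q (fdiff (fdiffs k g)) \<le> (r (Suc k))\<^sup>2 * energy w p q (fdiffs k g)
       + 3 * (2 * \<delta> ^ k)\<^sup>2 * (w p + w q) + ?X / (r (Suc (Suc k)))\<^sup>2"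
    proof (rule energy_ratio_step[where \<kappa> = \<kappa>])
      show "r (Suc k) = (1 + \<kappa>) * r (Suc (Suc k)) + \<kappa>" by (rule rS)
      show "r (Suc (Suc k)) > 0" using r_ge \<rho> by (metis less_le_trans)
      show "energy w p q (fdiff (fdiff (fdiffs k g))) \<le> (r (Suc (Suc k)))\<^sup>2 * energy w p q (fdiff (fdiffs k g)) + ?X"
        using step.IH by (simp add: E_def)
      show "?X \<ge> 0" using nn \<rho> by simp
      show "r (Suc k) \<le> 1" using r_le[of "Suc k"] by simp
    qed (use bd pq w w' \<kappa> in auto)
    \<comment> \<open>Going down one order divides the error by a squared ratio. As \<open>r\<close>
      is at least \<open>\<rho>\<close>, the factor \<open>\<rho> ^ (2 * Suc k)\<close> in
      \<open>?X\<close> pays for it and drops to \<open>\<rho> ^ (2 * k)\<close>.\<close>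
    also have "?X / (r (Suc (Suc k)))\<^sup>2 \<le> ?X / \<rho>\<^sup>2"
      using r_ge \<rho> nn by (intro divide_left_mono power_mono mult_pos_pos zero_less_power) (auto intro: less_le_trans)
    also have "?X / \<rho>\<^sup>2 = \<rho> ^ (2 * k) * (X + W / 16 ^ k)"
      using \<rho> by (simp add: power2_eq_square)
    also have "3 * (2 * \<delta> ^ k)\<^sup>2 * (w p + w q) = \<rho> ^ (2 * k) * (12 * W / 16 ^ k)"
      unfolding power_mult_distrib \<delta>2 W_def by simp
    \<comment> \<open>The boundary terms are dominated by a geometric series in 1/16: 12 from this
      order and 16/16 from the order above give 13, below the 16 in the claim.\<close>
    finally have "E (Suc k) \<le> (r (Suc k))\<^sup>2 * E k + \<rho> ^ (2 * k) * (12 * W / 16 ^ k)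
        + \<rho> ^ (2 * k) * (X + W / 16 ^ k)"
      by (simp add: E_def)
    also have "\<dots> = (r (Suc k))\<^sup>2 * E k + \<rho> ^ (2 * k) * (X + 13 * W / 16 ^ k)"
      by (simp add: algebra_simps)
    also have "\<dots> \<le> (r (Suc k))\<^sup>2 * E k + \<rho> ^ (2 * k) * (X + 16 * W / 16 ^ k)"
      using \<rho> nn by (intro add_left_mono mult_left_mono divide_right_mono mult_right_mono) auto
    finally show ?case .
  qed
  from this[of 0] have "E 1 \<le> (r 1)\<^sup>2 * E 0 + (X + 16 * W)" by simp
  also have "(r 1)\<^sup>2 * E 0 \<le> (1 / 2)\<^sup>2 * E 0"
  proof (intro mult_right_mono power_mono r_le)
    show "0 \<le> r 1" using r_ge[of 1] \<rho> by simp
  qed (auto simp: E_def energy_def intro!: sum_nonneg mult_nonneg_nonneg w)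
  also have "X \<le> 4 / 16 ^ H * (\<Sum>t\<in>{p..<q}. w t)"
    unfolding X_def using \<rho> w power_le_one[of \<rho> 2]
    by (intro mult_right_mono divide_right_mono sum_nonneg) auto
  finally show ?thesis by (simp add: E_def W_def power2_eq_square)
qed

section \<open>Regret of Optimistic Hedge for one player\<close>

definition is_dist :: "'a set \<Rightarrow> ('a \<Rightarrow> real) \<Rightarrow> bool" where
  "is_dist A p \<longleftrightarrow> finite A \<and> (\<forall>a\<in>A. 0 \<le> p a) \<and> (\<Sum>a\<in>A. p a) = 1"

definition mean :: "'a set \<Rightarrow> ('a \<Rightarrow> real) \<Rightarrow> ('a \<Rightarrow> real) \<Rightarrow> real" where
  "mean A p v = (\<Sum>a\<in>A. p a * v a)"

definition var :: "'a set \<Rightarrow> ('a \<Rightarrow> real) \<Rightarrow> ('a \<Rightarrow> real) \<Rightarrow> real" where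
  "var A p v = (\<Sum>a\<in>A. p a * (v a - mean A p v)\<^sup>2)"

lemma is_distD:
  assumes "is_dist A p"
  shows "finite A" "\<And>a. a \<in> A \<Longrightarrow> 0 \<le> p a" "(\<Sum>a\<in>A. p a) = 1"
  using assms by (auto simp: is_dist_def)

lemma mean_bounds:
  assumes "is_dist A p" "\<And>a. a \<in> A \<Longrightarrow> l \<le> v a \<and> v a \<le> u"
  shows "l \<le> mean A p v" "mean A p v \<le> u"
proof -
  note p = is_distD[OF assms(1)]
  have "(\<Sum>a\<in>A. p a * l) \<le> (\<Sum>a\<in>A. p a * v a)" "(\<Sum>a\<in>A. p a * v a) \<le> (\<Sum>a\<in>A. p a * u)"
    using p assms(2) by (auto intro!: sum_mono mult_left_mono)
  then show "l \<le> mean A p v" "mean A p v \<le> u"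
    unfolding mean_def sum_distrib_right[symmetric] p(3) by auto
qed

lemma mean_centered: "is_dist A p \<Longrightarrow> (\<Sum>a\<in>A. p a * (v a - mean A p v)) = 0"
  by (simp add: right_diff_distrib sum_subtractf is_dist_def mean_def flip: sum_distrib_right)

lemma var_nonneg: "is_dist A p \<Longrightarrow> var A p v \<ge> 0"
  by (auto simp: var_def is_dist_def intro!: sum_nonneg)

lemma var_le:
  assumes "is_dist A p" "\<And>a. a \<in> A \<Longrightarrow> l \<le> v a \<and> v a \<le> u"
  shows "var A p v \<le> (u - l)\<^sup>2"
proof -
  note p = is_distD[OF assms(1)] and m = mean_bounds[of A p l v u, OF assms]
  have "var A p v \<le> (\<Sum>a\<in>A. p a * (u - l)\<^sup>2)"
    unfolding var_def
  proof (intro sum_mono mult_left_mono p)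
    fix a assume "a \<in> A"
    then have "\<bar>v a - mean A p v\<bar> \<le> \<bar>u - l\<bar>" using assms(2)[of a] m by auto
    then show "(v a - mean A p v)\<^sup>2 \<le> (u - l)\<^sup>2" by (simp only: abs_le_square_iff)
  qed
  then show ?thesis unfolding sum_distrib_right[symmetric] p(3) by simp
qed

text \<open>The pair form removes the mean, which changes with the strategy. A sum of variances over
  time becomes a sum of energies of the scalar sequences \<open>v a - v b\<close> with weights
  \<open>p a * p b\<close>, to which the interpolation applies.\<close>

lemma var_eq_pairs:
  assumes "is_dist A p"
  shows "var A p v = (\<Sum>a\<in>A. \<Sum>b\<in>A. p a * p b * (v a - v b)\<^sup>2) / 2"
proof -
  note p = is_distD[OF assms]
  define y where "y a = v a - mean A p v" for a
  have y: "(\<Sum>a\<in>A. p a * y a) = 0" unfolding y_def by (rule mean_centered[OF assms])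
  have "(\<Sum>a\<in>A. \<Sum>b\<in>A. p a * p b * (v a - v b)\<^sup>2)
      = (\<Sum>a\<in>A. \<Sum>b\<in>A. (p a * (y a)\<^sup>2) * p b + p a * (p b * (y b)\<^sup>2) - 2 * ((p a * y a) * (p b * y b)))"
    by (intro sum.cong refl) (simp add: y_def power2_eq_square algebra_simps)
  also have "\<dots> = 2 * var A p v"
    unfolding sum_subtractf sum.distrib sum_distrib_left[symmetric] sum_distrib_right[symmetric] p(3) y
    by (simp add: var_def y_def)
  finally show ?thesis by simp
qed

section \<open>Second-order bounds on the log-moment generating function\<close>

lemma exp_quadratic_bounds:
  fixes y :: real
  shows "\<bar>y\<bar> \<le> 1 / 2 \<Longrightarrow> exp y \<le> 1 + y + y\<^sup>2"
    and "\<bar>y\<bar> \<le> 1 / 4 \<Longrightarrow> 1 + y + 3 / 8 * y\<^sup>2 \<le> exp y"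
proof -
  obtain t where t: "\<bar>t\<bar> \<le> \<bar>y\<bar>" "exp y = (\<Sum>m<2. y ^ m / fact m) + exp t / fact 2 * y ^ 2"
    using Maclaurin_exp_le[of y 2] by blast
  then have e: "exp y = 1 + y + exp t / 2 * y\<^sup>2" by (simp add: numeral_2_eq_2)
  show "exp y \<le> 1 + y + y\<^sup>2" if "\<bar>y\<bar> \<le> 1 / 2"
  proof -
    have "exp t \<le> exp (1 / 2)" using that t(1) by simp
    also have "\<dots> \<le> 1 + 1 / 2 + (1 / 2)\<^sup>2" by (rule exp_bound) auto
    finally have "exp t / 2 \<le> 1" by (simp add: power2_eq_square)
    from mult_right_mono[OF this, of "y\<^sup>2"] show ?thesis by (simp add: e)
  qed
  show "1 + y + 3 / 8 * y\<^sup>2 \<le> exp y" if "\<bar>y\<bar> \<le> 1 / 4"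
  proof -
    have "3 / 4 \<le> exp t" using exp_ge_add_one_self[of t] that t(1) by linarith
    then have "3 / 8 * y\<^sup>2 \<le> exp t / 2 * y\<^sup>2" by (intro mult_right_mono) auto
    then show ?thesis by (simp add: e)
  qed
qed

lemma mean_exp_centered:
  "mean A p (\<lambda>a. exp (\<theta> * v a)) = exp (\<theta> * mean A p v) * (\<Sum>a\<in>A. p a * exp (\<theta> * (v a - mean A p v)))"
  unfolding mean_def sum_distrib_left
  by (intro sum.cong refl) (simp add: exp_add[symmetric] algebra_simps flip: sum_distrib_left)

lemma mean_quadratic:
  assumes "is_dist A p"
  shows "(\<Sum>a\<in>A. p a * (1 + \<theta> * (v a - mean A p v) + c * (\<theta> * (v a - mean A p v))\<^sup>2))
     = 1 + c * \<theta>\<^sup>2 * var A p v"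
proof -
  let ?y = "\<lambda>a. v a - mean A p v"
  have "(\<Sum>a\<in>A. p a * (1 + \<theta> * ?y a + c * (\<theta> * ?y a)\<^sup>2))
     = (\<Sum>a\<in>A. p a + \<theta> * (p a * ?y a) + c * \<theta>\<^sup>2 * (p a * (?y a)\<^sup>2))"
    by (intro sum.cong refl) (simp add: power2_eq_square algebra_simps)
  then show ?thesis
    unfolding sum.distrib sum_distrib_left[symmetric] mean_centered[OF assms] is_distD(3)[OF assms]
    by (simp add: var_def)
qed

text \<open>After centring, the linear term has mean 0 and the quadratic one gives the variance. The
  range \<open>[-1, 1]\<close> is that of a difference of two losses; deviations up to 2, times 1/4,
  just meet the limit 1/2 of the quadratic bound on \<open>exp\<close>.\<close>

lemma ln_mean_exp_le:
  assumes p: "is_dist A p" and v: "\<And>a. a \<in> A \<Longrightarrow> -1 \<le> v a \<and> v a \<le> 1" and \<theta>: "\<bar>\<theta>\<bar> \<le> 1 / 4"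
  shows "mean A p (\<lambda>a. exp (\<theta> * v a)) > 0"
    "ln (mean A p (\<lambda>a. exp (\<theta> * v a))) \<le> \<theta> * mean A p v + \<theta>\<^sup>2 * var A p v"
proof -
  let ?y = "\<lambda>a. v a - mean A p v"
  have "exp (- 1 / 4) \<le> mean A p (\<lambda>a. exp (\<theta> * v a))"
  proof (rule mean_bounds(1)[OF p, where u = "exp (1 / 4)"])
    fix a assume a: "a \<in> A"
    have "\<bar>\<theta> * v a\<bar> \<le> 1 / 4 * 1"
      unfolding abs_mult using v[OF a] \<theta> by (intro mult_mono) auto
    then show "exp (- 1 / 4) \<le> exp (\<theta> * v a) \<and> exp (\<theta> * v a) \<le> exp (1 / 4)" by auto
  qed
  then show pos: "mean A p (\<lambda>a. exp (\<theta> * v a)) > 0" by (meson exp_gt_zero less_le_trans)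
  have le: "exp (\<theta> * ?y a) \<le> 1 + \<theta> * ?y a + 1 * (\<theta> * ?y a)\<^sup>2" if a: "a \<in> A" for a
  proof -
    have "\<bar>?y a\<bar> \<le> 2" using v[OF a] mean_bounds[of A p _ v, OF p v] by auto
    then have "\<bar>\<theta> * ?y a\<bar> \<le> 1 / 4 * 2" unfolding abs_mult using \<theta> by (intro mult_mono) auto
    then show ?thesis using exp_quadratic_bounds(1) by simp
  qed
  have "(\<Sum>a\<in>A. p a * exp (\<theta> * ?y a)) \<le> 1 + 1 * \<theta>\<^sup>2 * var A p v"
    unfolding mean_quadratic[OF p, symmetric]
    using le by (intro sum_mono mult_left_mono is_distD(2)[OF p]) auto
  also have "\<dots> \<le> exp (\<theta>\<^sup>2 * var A p v)" by (simp add: exp_ge_add_one_self)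
  finally have "mean A p (\<lambda>a. exp (\<theta> * v a)) \<le> exp (\<theta> * mean A p v) * exp (\<theta>\<^sup>2 * var A p v)"
    unfolding mean_exp_centered by (intro mult_left_mono) auto
  also have "\<dots> = exp (\<theta> * mean A p v + \<theta>\<^sup>2 * var A p v)" by (simp add: exp_add)
  finally show "ln (mean A p (\<lambda>a. exp (\<theta> * v a))) \<le> \<theta> * mean A p v + \<theta>\<^sup>2 * var A p v"
    using pos by (metis exp_gt_zero ln_exp ln_le_cancel_iff)
qed

text \<open>The source of the negative variance term. On \<open>[0, 1]\<close> deviations are at
  most 1, which allows the coefficient 3/8; passing to the logarithm by
  \<open>ln (1 + z) \<ge> z - z\<^sup>2\<close> with \<open>z \<le> 1 / 3\<close> costs a third of
  it, and 1/4 remains.\<close>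

lemma ln_mean_exp_ge:
  assumes p: "is_dist A p" and v: "\<And>a. a \<in> A \<Longrightarrow> 0 \<le> v a \<and> v a \<le> 1" and \<theta>: "\<bar>\<theta>\<bar> \<le> 1 / 4"
  shows "ln (mean A p (\<lambda>a. exp (\<theta> * v a))) \<ge> \<theta> * mean A p v + \<theta>\<^sup>2 / 4 * var A p v"
proof -
  let ?y = "\<lambda>a. v a - mean A p v"
  define z where "z = 3 / 8 * \<theta>\<^sup>2 * var A p v"
  have "var A p v \<le> (1 - 0)\<^sup>2" by (rule var_le[OF p v])
  moreover have "\<theta>\<^sup>2 \<le> (1 / 4)\<^sup>2" using \<theta> by (simp add: abs_le_square_iff[symmetric])
  ultimately have "\<theta>\<^sup>2 * var A p v \<le> (1 / 4)\<^sup>2 * (1 - 0)\<^sup>2"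
    using var_nonneg[OF p] by (intro mult_mono) auto
  then have z: "0 \<le> z" "z \<le> 1 / 3" using var_nonneg[OF p, of v] by (auto simp: z_def power2_eq_square)
  have ge: "1 + \<theta> * ?y a + 3 / 8 * (\<theta> * ?y a)\<^sup>2 \<le> exp (\<theta> * ?y a)" if a: "a \<in> A" for a
  proof -
    have "\<bar>?y a\<bar> \<le> 1" using v[OF a] mean_bounds[of A p _ v, OF p v] by auto
    then have "\<bar>\<theta> * ?y a\<bar> \<le> 1 / 4 * 1" unfolding abs_mult using \<theta> by (intro mult_mono) auto
    then show ?thesis using exp_quadratic_bounds(2) by simp
  qed
  have "1 + z \<le> (\<Sum>a\<in>A. p a * exp (\<theta> * ?y a))"
    unfolding z_def mean_quadratic[OF p, symmetric]
    using ge by (intro sum_mono mult_left_mono is_distD(2)[OF p]) auto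
  then have "exp (\<theta> * mean A p v) * (1 + z) \<le> mean A p (\<lambda>a. exp (\<theta> * v a))"
    unfolding mean_exp_centered by (intro mult_left_mono) auto
  then have "ln (exp (\<theta> * mean A p v) * (1 + z)) \<le> ln (mean A p (\<lambda>a. exp (\<theta> * v a)))"
    using z by (intro ln_mono) auto
  moreover have "ln (exp (\<theta> * mean A p v) * (1 + z)) = \<theta> * mean A p v + ln (1 + z)"
    using z by (simp add: ln_mult)
  moreover have "z - z\<^sup>2 \<le> ln (1 + z)" using z by (intro ln_one_plus_pos_lower_bound) auto
  moreover have "z * z \<le> z * (1 / 3)" using z by (intro mult_left_mono) auto
  moreover have "2 / 3 * z = \<theta>\<^sup>2 / 4 * var A p v" by (simp add: z_def)
  ultimately show ?thesis by (simp add: power2_eq_square)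
qed

definition softmax :: "'a set \<Rightarrow> ('a \<Rightarrow> real) \<Rightarrow> 'a \<Rightarrow> real" where
  "softmax A v a = exp (v a) / (\<Sum>b\<in>A. exp (v b))"

lemma sum_exp_pos: "finite A \<Longrightarrow> A \<noteq> {} \<Longrightarrow> (\<Sum>b\<in>A. exp (v b :: real)) > 0"
  by (intro sum_pos) auto

lemma is_dist_softmax: "finite A \<Longrightarrow> A \<noteq> {} \<Longrightarrow> is_dist A (softmax A v)"
  using sum_exp_pos[of A v] by (auto simp: is_dist_def softmax_def simp flip: sum_divide_distrib)

lemma mean_softmax_exp:
  "mean A (softmax A v) (\<lambda>a. exp (w a)) = (\<Sum>a\<in>A. exp (v a + w a)) / (\<Sum>a\<in>A. exp (v a))"
  by (simp add: mean_def softmax_def exp_add sum_divide_distrib)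

text \<open>
  The log-partition function of the cumulative losses \<open>U\<close> telescopes. Its increments are taken
  relative to the optimistic strategy, which is tilted by the most recent loss vector.
\<close>

lemma optimistic_hedge_regret:
  fixes l :: "nat \<Rightarrow> 'a \<Rightarrow> real"
  assumes A: "finite A" "b \<in> A" and \<eta>: "0 < \<eta>" "\<eta> \<le> 1 / 4"
    and l: "\<And>t a. a \<in> A \<Longrightarrow> 0 \<le> l t a \<and> l t a \<le> 1"
    and U: "U = (\<lambda>t a. \<Sum>s\<in>{1..t}. l s a)"
    and x: "\<And>t. x (Suc t) = softmax A (\<lambda>a. - \<eta> * (U t a + l t a))"
  shows "(\<Sum>t<T. mean A (x (Suc t)) (l (Suc t))) - U T b \<le> ln (card A) / \<eta>
     + (\<Sum>t<T. \<eta> * var A (x (Suc t)) (\<lambda>a. l (Suc t) a - l t a) - \<eta> / 4 * var A (x (Suc t)) (l t))"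
proof -
  define Z where "Z t = (\<Sum>a\<in>A. exp (- \<eta> * U t a))" for t
  have Zpos: "Z t > 0" for t unfolding Z_def using A by (intro sum_exp_pos) auto
  have step: "ln (Z (Suc t)) - ln (Z t) \<le> - \<eta> * mean A (x (Suc t)) (l (Suc t))
     + (\<eta>\<^sup>2 * var A (x (Suc t)) (\<lambda>a. l (Suc t) a - l t a) - \<eta>\<^sup>2 / 4 * var A (x (Suc t)) (l t))" for t
  proof -
    let ?x = "x (Suc t)" and ?d = "\<lambda>a. l (Suc t) a - l t a"
    have xd: "is_dist A ?x" unfolding x using A by (intro is_dist_softmax) auto
    \<comment> \<open>The normaliser of the optimistic strategy. Under this strategy
      \<open>Z (Suc t) / N\<close> is an exponential moment of the prediction error
      \<open>l (Suc t) - l t\<close>, and \<open>Z t / N\<close> one of \<open>l t\<close> with the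
      opposite sign. Bounding the former above and the latter below gives the increment of
      \<open>ln Z\<close>, and \<open>N\<close> cancels.\<close>
    define N where "N = (\<Sum>a\<in>A. exp (- \<eta> * (U t a + l t a)))"
    have N: "N > 0" unfolding N_def using A by (intro sum_exp_pos) auto
    have "U (Suc t) a = U t a + l (Suc t) a" for a by (simp add: U)
    then have 1: "mean A ?x (\<lambda>a. exp (- \<eta> * ?d a)) = Z (Suc t) / N"
      unfolding x mean_softmax_exp Z_def N_def
      by (intro arg_cong2[of _ _ _ _ "(/)"] sum.cong refl) (simp add: algebra_simps)
    have 2: "mean A ?x (\<lambda>a. exp (\<eta> * l t a)) = Z t / N"
      unfolding x mean_softmax_exp Z_def N_def
      by (intro arg_cong2[of _ _ _ _ "(/)"] sum.cong refl) (simp add: algebra_simps)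
    have "ln (Z (Suc t) / N) \<le> - \<eta> * mean A ?x ?d + (- \<eta>)\<^sup>2 * var A ?x ?d"
      unfolding 1[symmetric]
    proof (rule ln_mean_exp_le(2)[OF xd])
      show "- 1 \<le> ?d a \<and> ?d a \<le> 1" if "a \<in> A" for a using l[OF that, of t] l[OF that, of "Suc t"] by auto
    qed (use \<eta> in auto)
    moreover have "ln (Z t / N) \<ge> \<eta> * mean A ?x (l t) + \<eta>\<^sup>2 / 4 * var A ?x (l t)"
      unfolding 2[symmetric] using \<eta> by (intro ln_mean_exp_ge[OF xd] l) auto
    moreover have "mean A ?x ?d = mean A ?x (l (Suc t)) - mean A ?x (l t)"
      by (simp add: mean_def right_diff_distrib sum_subtractf)
    ultimately show ?thesis using N Zpos[of t] Zpos[of "Suc t"] by (simp add: ln_div algebra_simps)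
  qed
  have "(\<Sum>t<T. ln (Z (Suc t)) - ln (Z t)) = ln (Z T) - ln (Z 0)"
    by (rule sum_lessThan_telescope)
  moreover have "Z 0 = card A" by (simp add: Z_def U)
  moreover have "- \<eta> * U T b \<le> ln (Z T)"
  proof -
    have "exp (- \<eta> * U T b) \<le> Z T" unfolding Z_def by (rule member_le_sum) (use A in auto)
    then show ?thesis using Zpos by (metis exp_gt_zero ln_exp ln_le_cancel_iff)
  qed
  moreover have "(\<Sum>t<T. ln (Z (Suc t)) - ln (Z t)) \<le> (\<Sum>t<T. - \<eta> * mean A (x (Suc t)) (l (Suc t))
     + (\<eta>\<^sup>2 * var A (x (Suc t)) (\<lambda>a. l (Suc t) a - l t a) - \<eta>\<^sup>2 / 4 * var A (x (Suc t)) (l t)))"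
    by (intro sum_mono step)
  ultimately have "- \<eta> * U T b \<le> ln (card A) + (\<Sum>t<T. - \<eta> * mean A (x (Suc t)) (l (Suc t))
     + (\<eta>\<^sup>2 * var A (x (Suc t)) (\<lambda>a. l (Suc t) a - l t a) - \<eta>\<^sup>2 / 4 * var A (x (Suc t)) (l t)))"
    by simp
  also have "\<dots> = ln (card A) - \<eta> * (\<Sum>t<T. mean A (x (Suc t)) (l (Suc t)))
     + \<eta> * (\<Sum>t<T. \<eta> * var A (x (Suc t)) (\<lambda>a. l (Suc t) a - l t a) - \<eta> / 4 * var A (x (Suc t)) (l t))"
    unfolding sum_distrib_left sum.distrib by (simp add: power2_eq_square algebra_simps sum_negf)
  finally have "\<eta> * ((\<Sum>t<T. mean A (x (Suc t)) (l (Suc t))) - U T b) \<le> \<eta> * (ln (card A) / \<eta>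
     + (\<Sum>t<T. \<eta> * var A (x (Suc t)) (\<lambda>a. l (Suc t) a - l t a) - \<eta> / 4 * var A (x (Suc t)) (l t)))"
    using \<eta> by (simp add: algebra_simps)
  then show ?thesis using \<eta> by (simp only: mult_le_cancel_left_pos)
qed

section \<open>Products of perturbed distributions\<close>

text \<open>With the difference written through its coefficients, the square is a double sum over
  times \<open>s\<close>, \<open>s'\<close>. For each fixed pair of times the integrand is a product
  over the coordinates, so its mean under the product measure factorises.\<close>

lemma sum_PiE_square:
  fixes p :: "'i \<Rightarrow> 'a \<Rightarrow> real" and \<phi> :: "'i \<Rightarrow> 'a \<Rightarrow> nat \<Rightarrow> real"
  assumes J: "finite J" "\<And>j. j \<in> J \<Longrightarrow> finite (A j)"
  shows "(\<Sum>a\<in>PiE J A. (\<Prod>j\<in>J. p j (a j)) * (\<Sum>s\<le>h. c s * (\<Prod>j\<in>J. \<phi> j (a j) s))\<^sup>2)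
    = (\<Sum>s\<le>h. \<Sum>s'\<le>h. c s * c s' * (\<Prod>j\<in>J. \<Sum>b\<in>A j. p j b * (\<phi> j b s * \<phi> j b s')))"
proof -
  have "(\<Sum>a\<in>PiE J A. (\<Prod>j\<in>J. p j (a j)) * (\<Sum>s\<le>h. c s * (\<Prod>j\<in>J. \<phi> j (a j) s))\<^sup>2)
     = (\<Sum>a\<in>PiE J A. \<Sum>s\<le>h. \<Sum>s'\<le>h. c s * c s' * (\<Prod>j\<in>J. p j (a j) * (\<phi> j (a j) s * \<phi> j (a j) s')))"
    unfolding power2_eq_square sum_product prod.distrib
    by (intro sum.cong refl) (simp add: sum_distrib_left mult_ac)
  also have "\<dots> = (\<Sum>s\<le>h. \<Sum>s'\<le>h. c s * c s' * (\<Sum>a\<in>PiE J A. \<Prod>j\<in>J. p j (a j) * (\<phi> j (a j) s * \<phi> j (a j) s')))"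
    unfolding sum_distrib_left by (subst sum.swap) (intro sum.cong refl sum.swap)
  finally show ?thesis using J by (simp add: prod_sum_PiE)
qed

lemma is_dist_PiE:
  assumes "finite J" "\<And>j. j \<in> J \<Longrightarrow> is_dist (A j) (p j)"
  shows "is_dist (PiE J A) (\<lambda>a. \<Prod>j\<in>J. p j (a j))"
proof -
  have "(\<Sum>a\<in>PiE J A. \<Prod>j\<in>J. p j (a j)) = (\<Prod>j\<in>J. \<Sum>b\<in>A j. p j b)"
    using assms by (subst prod_sum_PiE) (auto simp: is_dist_def)
  also have "\<dots> = 1" using assms(2) by (simp add: is_dist_def)
  finally show ?thesis
    using assms by (auto simp: is_dist_def intro!: finite_PiE prod_nonneg)
qed

lemma mean_square_le:
  assumes "is_dist A p"
  shows "(mean A p v)\<^sup>2 \<le> mean A p (\<lambda>a. (v a)\<^sup>2)"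
proof -
  note p = is_distD[OF assms]
  have "var A p v = (\<Sum>a\<in>A. p a * (v a)\<^sup>2 - 2 * mean A p v * (p a * v a) + (mean A p v)\<^sup>2 * p a)"
    unfolding var_def by (intro sum.cong refl) (simp add: power2_eq_square algebra_simps)
  also have "\<dots> = mean A p (\<lambda>a. (v a)\<^sup>2) - 2 * mean A p v * mean A p v + (mean A p v)\<^sup>2"
    unfolding sum.distrib sum_subtractf sum_distrib_left[symmetric] p(3) by (simp add: mean_def)
  finally show ?thesis using var_nonneg[OF assms, of v] by (simp add: power2_eq_square)
qed

text \<open>
  Expanding a product of centred perturbations \<open>1 + u\<^sub>j\<close> over subsets of the players gives orthogonal
  terms. So the perturbations add up in square mean, which is the origin of the factor \<open>sqrt n\<close>
  (instead of \<open>n\<close>) in the regret bound.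
\<close>

lemma fdiffs_product_mean_le:
  fixes p :: "'i \<Rightarrow> 'a \<Rightarrow> real" and u :: "'i \<Rightarrow> 'a \<Rightarrow> nat \<Rightarrow> real"
  assumes R: "R > 0" and h: "h > 0" and J: "finite J"
    and p: "\<And>j. j \<in> J \<Longrightarrow> is_dist (A j) (p j)"
    and u0: "\<And>j s. j \<in> J \<Longrightarrow> (\<Sum>b\<in>A j. p j b * u j b s) = 0"
    and u: "\<And>j b. j \<in> J \<Longrightarrow> b \<in> A j \<Longrightarrow> window_norm R h (u j b) \<le> \<gamma>" and \<gamma>: "\<gamma> \<ge> 0"
    and F: "\<And>a. a \<in> PiE J A \<Longrightarrow> \<bar>F a\<bar> \<le> 1"
  shows "(fdiffs h (\<lambda>s. \<Sum>a\<in>PiE J A. F a * (\<Prod>j\<in>J. p j (a j) * (1 + u j (a j) s))) 0)\<^sup>2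
     \<le> (wt R h / 8)\<^sup>2 * ((1 + \<gamma>\<^sup>2) ^ card J - 1)"
proof -
  obtain c where c: "\<And>f t. fdiffs h f t = (\<Sum>s\<le>h. c s * f (t + s))" using fdiffs_coeffs by blast
  define P where "P a = (\<Prod>j\<in>J. p j (a j))" for a
  define X where "X a = fdiffs h (\<lambda>s. \<Prod>j\<in>J. 1 + u j (a j) s) 0" for a
  define Y where "Y S a = fdiffs h (\<lambda>s. \<Prod>j\<in>S. u j (a j) s) 0" for S a
  define m where "m j s s' = (\<Sum>b\<in>A j. p j b * (u j b s * u j b s'))" for j s s'
  have fin: "\<And>j. j \<in> J \<Longrightarrow> finite (A j)" using p is_distD(1) by blast
  have Pd: "is_dist (PiE J A) P" unfolding P_def by (rule is_dist_PiE[OF J p])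
  note Pd' = is_distD[OF Pd]

  have XX: "(\<Sum>a\<in>PiE J A. P a * (X a)\<^sup>2) = (\<Sum>s\<le>h. \<Sum>s'\<le>h. c s * c s' * (\<Prod>j\<in>J. m j s s' + 1))"
  proof -
    have "(\<Sum>b\<in>A j. p j b * ((1 + u j b s) * (1 + u j b s'))) = m j s s' + 1" if j: "j \<in> J" for j s s'
    proof -
      have "(\<Sum>b\<in>A j. p j b * ((1 + u j b s) * (1 + u j b s')))
        = (\<Sum>b\<in>A j. p j b + p j b * u j b s + p j b * u j b s' + p j b * (u j b s * u j b s'))"
        by (intro sum.cong refl) (simp add: algebra_simps)
      then show ?thesis
        unfolding sum.distrib u0[OF j] is_distD(3)[OF p[OF j]] by (simp add: m_def)
    qed
    then show ?thesis unfolding X_def P_def c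
      using sum_PiE_square[OF J fin, where p = p and \<phi> = "\<lambda>j b s. 1 + u j b s" and h = h and c = c] by simp
  qed
  have YY: "(\<Sum>a\<in>PiE J A. P a * (Y S a)\<^sup>2) = (\<Sum>s\<le>h. \<Sum>s'\<le>h. c s * c s' * (\<Prod>j\<in>S. m j s s'))"
    if S: "S \<subseteq> J" for S
  proof -
    have 1: "(\<Prod>j\<in>J. if j \<in> S then f j else 1) = (\<Prod>j\<in>S. f j)" for f :: "'i \<Rightarrow> real"
      using S J by (simp add: prod.If_cases Int_absorb1 Int_absorb2)
    have 2: "(\<Sum>b\<in>A j. p j b * ((if j \<in> S then u j b s else 1) * (if j \<in> S then u j b s' else 1)))
        = (if j \<in> S then m j s s' else 1)" if "j \<in> J" for j s s'
      using is_distD(3)[OF p[OF that]] by (simp add: m_def)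
    have "(\<Sum>a\<in>PiE J A. P a * (Y S a)\<^sup>2)
      = (\<Sum>s\<le>h. \<Sum>s'\<le>h. c s * c s' * (\<Prod>j\<in>J. if j \<in> S then m j s s' else 1))"
      using sum_PiE_square[OF J fin, where p = p and \<phi> = "\<lambda>j b s. if j \<in> S then u j b s else 1" and h = h and c = c]
      by (simp add: Y_def P_def c 1 2)
    then show ?thesis by (simp only: 1)
  qed
  \<comment> \<open>Parseval's identity without computing mixed terms: centring turns each factor of
    \<open>XX\<close> into \<open>m j s s' + 1\<close>, and expanding this product over subsets
    gives precisely the right-hand sides of \<open>YY\<close>.\<close>
  have expand: "(\<Sum>a\<in>PiE J A. P a * (X a)\<^sup>2) = (\<Sum>S\<in>Pow J. \<Sum>a\<in>PiE J A. P a * (Y S a)\<^sup>2)"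
  proof -
    have "(\<Sum>a\<in>PiE J A. P a * (X a)\<^sup>2) = (\<Sum>s\<le>h. \<Sum>s'\<le>h. \<Sum>S\<in>Pow J. c s * c s' * (\<Prod>j\<in>S. m j s s'))"
      unfolding XX prod_add[OF J] sum_distrib_left by simp
    also have "\<dots> = (\<Sum>s\<le>h. \<Sum>S\<in>Pow J. \<Sum>s'\<le>h. c s * c s' * (\<Prod>j\<in>S. m j s s'))"
      by (intro sum.cong refl sum.swap)
    also have "\<dots> = (\<Sum>S\<in>Pow J. \<Sum>s\<le>h. \<Sum>s'\<le>h. c s * c s' * (\<Prod>j\<in>S. m j s s'))"
      by (rule sum.swap)
    also have "\<dots> = (\<Sum>S\<in>Pow J. \<Sum>a\<in>PiE J A. P a * (Y S a)\<^sup>2)"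
      by (intro sum.cong refl) (simp add: YY)
    finally show ?thesis .
  qed
  define q where "q = (wt R h / 8)\<^sup>2"
  \<comment> \<open>For \<open>S = {}\<close> the product is the constant 1, whose difference
    vanishes because \<open>h > 0\<close>. Subtracting \<open>q\<close> there yields the
    \<open>- 1\<close> in the final bound.\<close>
  have Yle: "(\<Sum>a\<in>PiE J A. P a * (Y S a)\<^sup>2) \<le> q * (\<gamma>\<^sup>2) ^ card S - (if S = {} then q else 0)" if S: "S \<subseteq> J" for S
  proof (cases "S = {}")
    case True
    then show ?thesis using h by (simp add: Y_def fdiffs_const)
  next
    case False
    have "(Y S a)\<^sup>2 \<le> q * (\<gamma>\<^sup>2) ^ card S" if a: "a \<in> PiE J A" for a
    proof -
      have "window_norm R h (\<lambda>s. \<Prod>j\<in>S. u j (a j) s) \<le> \<gamma> ^ card S"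
        using S J False a \<gamma> by (intro window_norm_prod[OF R] u) (auto intro: finite_subset)
      then have "\<bar>Y S a\<bar> \<le> \<gamma> ^ card S / 8 * wt R h"
        unfolding Y_def window_norm_le_iff[OF R] by simp
      from power_mono[OF this, of 2] show ?thesis
        by (simp add: q_def power_mult_distrib power_divide power_mult[symmetric] mult.commute)
    qed
    then have "(\<Sum>a\<in>PiE J A. P a * (Y S a)\<^sup>2) \<le> (\<Sum>a\<in>PiE J A. P a * (q * (\<gamma>\<^sup>2) ^ card S))"
      by (intro sum_mono mult_left_mono Pd')
    then show ?thesis using False unfolding sum_distrib_right[symmetric] Pd'(3) by simp
  qed
  have "(\<Sum>a\<in>PiE J A. P a * (X a)\<^sup>2) \<le> (\<Sum>S\<in>Pow J. q * (\<gamma>\<^sup>2) ^ card S - (if S = {} then q else 0))"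
    unfolding expand by (intro sum_mono Yle) auto
  also have "\<dots> = q * ((1 + \<gamma>\<^sup>2) ^ card J - 1)"
  proof -
    have "(\<Sum>S\<in>Pow J. (\<gamma>\<^sup>2) ^ card S) = (\<gamma>\<^sup>2 + 1) ^ card J"
      using prod_add[OF J, of "\<lambda>_. \<gamma>\<^sup>2" "\<lambda>_. 1"] by simp
    moreover have "(\<Sum>S\<in>Pow J. if S = {} then q else 0) = q"
      using J by (simp add: sum.delta)
    ultimately show ?thesis
      unfolding sum_subtractf sum_distrib_left[symmetric] by (simp add: algebra_simps)
  qed
  finally have X2: "(\<Sum>a\<in>PiE J A. P a * (X a)\<^sup>2) \<le> q * ((1 + \<gamma>\<^sup>2) ^ card J - 1)" .

  have "fdiffs h (\<lambda>s. \<Sum>a\<in>PiE J A. F a * (\<Prod>j\<in>J. p j (a j) * (1 + u j (a j) s))) 0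
      = (\<Sum>a\<in>PiE J A. fdiffs h (\<lambda>s. F a * P a * (\<Prod>j\<in>J. 1 + u j (a j) s)) 0)"
    unfolding fdiffs_sum by (intro sum.cong refl) (simp add: prod.distrib P_def mult.assoc)
  also have "\<dots> = (\<Sum>a\<in>PiE J A. F a * P a * X a)" unfolding fdiffs_cmult X_def ..
  finally have eq: "fdiffs h (\<lambda>s. \<Sum>a\<in>PiE J A. F a * (\<Prod>j\<in>J. p j (a j) * (1 + u j (a j) s))) 0
      = (\<Sum>a\<in>PiE J A. F a * P a * X a)" .
  have "\<bar>\<Sum>a\<in>PiE J A. F a * P a * X a\<bar> \<le> mean (PiE J A) P (\<lambda>a. \<bar>X a\<bar>)"
    unfolding mean_def
  proof (intro order_trans[OF sum_abs] sum_mono)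
    fix a assume a: "a \<in> PiE J A"
    have "\<bar>F a\<bar> * (P a * \<bar>X a\<bar>) \<le> 1 * (P a * \<bar>X a\<bar>)"
      using Pd'(2)[OF a] F[OF a] by (intro mult_right_mono) auto
    then show "\<bar>F a * P a * X a\<bar> \<le> P a * \<bar>X a\<bar>" using Pd'(2)[OF a] by (simp add: abs_mult mult.assoc)
  qed
  then have "(\<Sum>a\<in>PiE J A. F a * P a * X a)\<^sup>2 \<le> (mean (PiE J A) P (\<lambda>a. \<bar>X a\<bar>))\<^sup>2"
    by (metis abs_ge_zero power2_abs power_mono)
  also have "\<dots> \<le> mean (PiE J A) P (\<lambda>a. \<bar>X a\<bar>\<^sup>2)" by (rule mean_square_le[OF Pd])
  also have "\<dots> = (\<Sum>a\<in>PiE J A. P a * (X a)\<^sup>2)" by (simp add: mean_def)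
  also note X2
  finally show ?thesis unfolding eq q_def .
qed

section \<open>Smoothness of the losses in self-play\<close>

text \<open>The price \<open>4 * R\<close> of one order of differences, paid because the strategies
  depend on summed losses. The 4 bounds \<open>((k + 2) / (k + 1))\<^sup>2\<close>.\<close>

lemma wt_Suc:
  assumes "R > 0"
  shows "wt R k \<le> 4 * R * wt R (Suc k)"
proof -
  define y where "y = real k + 1"
  have y: "y \<ge> 1" by (simp add: y_def)
  have "(y + 1)\<^sup>2 \<le> (2 * y)\<^sup>2" using y by (intro power_mono) auto
  then have "(y + 1)\<^sup>2 \<le> 4 * y\<^sup>2" by (simp add: power_mult_distrib)
  moreover have "4 * y\<^sup>2 \<le> y * (4 * y\<^sup>2)" using mult_right_mono[OF y, of "4 * y\<^sup>2"] by simp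
  ultimately have "(y + 1)\<^sup>2 \<le> 4 * y * y\<^sup>2" by simp
  then have "1 / y\<^sup>2 \<le> 4 * y / (y + 1)\<^sup>2" using y by (simp add: field_simps)
  then have "fact k / R ^ k * (1 / y\<^sup>2) \<le> fact k / R ^ k * (4 * y / (y + 1)\<^sup>2)"
    using assms by (intro mult_left_mono) auto
  also have "\<dots> = 4 * R * wt R (Suc k)"
  proof -
    have "wt R (Suc k) = fact k * y / (R * R ^ k * (y + 1)\<^sup>2)" by (simp add: wt_def y_def add_ac)
    then show ?thesis using assms by simp
  qed
  finally show ?thesis by (simp add: wt_def y_def)
qed

locale optimistic_hedge_game =
  fixes n :: nat and d :: "nat \<Rightarrow> nat" and L :: "nat \<Rightarrow> (nat \<Rightarrow> nat) \<Rightarrow> real"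
    and \<eta> :: real and x :: "nat \<Rightarrow> nat \<Rightarrow> nat \<Rightarrow> real"
  assumes game: "is_game n d L" and play: "optimistic_hedge_play n d L \<eta> x" and \<eta>: "\<eta> > 0"
begin

abbreviation "A i \<equiv> {1..d i}"

definition l :: "nat \<Rightarrow> nat \<Rightarrow> nat \<Rightarrow> real" where
  "l i t b = feedback n d L x t i b"

definition U :: "nat \<Rightarrow> nat \<Rightarrow> nat \<Rightarrow> real" where
  "U i t b = (\<Sum>s\<in>{1..t}. l i s b)"

lemma A_ne: "i \<in> {1..n} \<Longrightarrow> A i \<noteq> {}"
  using game by (auto simp: is_game_def)

text \<open>The increments \<open>2 * l s - l (s - 1)\<close> sum to \<open>U t + l t\<close>,
  thanks to \<open>l 0 = 0\<close>; the same convention makes the uniform start the case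
  \<open>t = 0\<close>.\<close>

lemma x_eq_softmax:
  assumes "i \<in> {1..n}" "a \<in> A i"
  shows "x (Suc t) i a = softmax (A i) (\<lambda>b. - \<eta> * (U i t b + l i t b)) a"
  using assms(2)
proof (induction t arbitrary: a)
  case 0
  then show ?case using play assms(1)
    by (simp add: optimistic_hedge_play_def softmax_def U_def l_def feedback_def)
next
  case (Suc t)
  let ?N = "\<Sum>b\<in>A i. exp (- \<eta> * (U i t b + l i t b))"
  have N: "?N > 0" by (intro sum_exp_pos A_ne assms) auto
  have num: "x (Suc t) i b * exp (- \<eta> * (2 * l i (Suc t) b - l i t b))
     = exp (- \<eta> * (U i (Suc t) b + l i (Suc t) b)) / ?N" if "b \<in> A i" for b
    using that unfolding Suc.IH[OF that] softmax_def
    by (simp add: U_def exp_add[symmetric] algebra_simps)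
  have step: "\<forall>t\<ge>1. \<forall>i\<in>{1..n}. \<forall>a\<in>A i. x (t + 1) i a =
      x t i a * exp (- \<eta> * (2 * l i t a - l i (t - 1) a)) /
          (\<Sum>b\<in>A i. x t i b * exp (- \<eta> * (2 * l i t b - l i (t - 1) b)))"
    using play unfolding optimistic_hedge_play_def l_def by blast
  have "x (Suc (Suc t)) i a = x (Suc t) i a * exp (- \<eta> * (2 * l i (Suc t) a - l i t a)) /
     (\<Sum>b\<in>A i. x (Suc t) i b * exp (- \<eta> * (2 * l i (Suc t) b - l i t b)))"
    using step[rule_format, of "Suc t" i a] assms(1) Suc.prems by simp
  also have "\<dots> = (exp (- \<eta> * (U i (Suc t) a + l i (Suc t) a)) / ?N) /
     (\<Sum>b\<in>A i. exp (- \<eta> * (U i (Suc t) b + l i (Suc t) b)) / ?N)"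
    using num Suc.prems by (intro arg_cong2[of _ _ _ _ "(/)"] sum.cong) auto
  also have "\<dots> = softmax (A i) (\<lambda>b. - \<eta> * (U i (Suc t) b + l i (Suc t) b)) a"
    unfolding softmax_def sum_divide_distrib[symmetric] using N by simp
  finally show ?case .
qed

lemma x_pos: "i \<in> {1..n} \<Longrightarrow> a \<in> A i \<Longrightarrow> t \<ge> 1 \<Longrightarrow> x t i a > 0"
  using x_eq_softmax[of i a "t - 1"] sum_exp_pos[OF _ A_ne, of i] by (simp add: softmax_def)

lemma is_dist_x: "i \<in> {1..n} \<Longrightarrow> t \<ge> 1 \<Longrightarrow> is_dist (A i) (x t i)"
  using is_dist_softmax[OF _ A_ne, of i "\<lambda>b. - \<eta> * (U i (t - 1) b + l i (t - 1) b)"]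
    x_eq_softmax[of i _ "t - 1"]
  by (simp add: is_dist_def)

lemma fun_upd_in_profiles:
  "i \<in> {1..n} \<Longrightarrow> b \<in> A i \<Longrightarrow> a \<in> profiles_without n d i \<Longrightarrow> a(i := b) \<in> profiles n d"
  using PiE_fun_upd[of b A i a "{1..n} - {i}"]
  by (simp add: profiles_def profiles_without_def insert_absorb)

lemma L_bounds:
  "i \<in> {1..n} \<Longrightarrow> a \<in> profiles n d \<Longrightarrow> 0 \<le> L i a \<and> L i a \<le> 1"
  using game by (auto simp: is_game_def)

lemma l_eq: "t \<ge> 1 \<Longrightarrow> l i t b =
   (\<Sum>a\<in>PiE ({1..n} - {i}) A. L i (a(i := b)) * (\<Prod>j\<in>{1..n} - {i}. x t j (a j)))"
  by (simp add: l_def feedback_def expected_loss_def profiles_without_def)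

lemma l_bounds:
  assumes "i \<in> {1..n}" "b \<in> A i"
  shows "0 \<le> l i t b \<and> l i t b \<le> 1"
proof (cases "t = 0")
  case True
  then show ?thesis by (simp add: l_def feedback_def)
next
  case False
  let ?J = "{1..n} - {i}"
  let ?p = "\<lambda>a. \<Prod>j\<in>?J. x t j (a j)"
  have p: "is_dist (PiE ?J A) ?p" using False by (intro is_dist_PiE is_dist_x) auto
  have "l i t b = mean (PiE ?J A) ?p (\<lambda>a. L i (a(i := b)))"
    using False by (simp add: l_eq mean_def mult.commute)
  moreover have "0 \<le> L i (a(i := b)) \<and> L i (a(i := b)) \<le> 1" if "a \<in> PiE ?J A" for a
    using that assms by (intro L_bounds fun_upd_in_profiles) (auto simp: profiles_without_def)
  ultimately show ?thesis using mean_bounds[OF p, of 0 "\<lambda>a. L i (a(i := b))" 1] by simp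
qed

text \<open>
  The start \<open>t \<ge> Suc h\<close> of the range depends on \<open>h\<close>: the convention \<open>l 0 = 0\<close> makes the sequence
  non-smooth at time 0, and each further difference looks one step further back.
\<close>

lemma fdiffs_l_le:
  assumes R: "R > 0" "real n * (768 * \<eta> * R)\<^sup>2 \<le> 1" "real h \<le> R"
    and "i \<in> {1..n}" "b \<in> A i" "t \<ge> Suc h"
  shows "\<bar>fdiffs h (\<lambda>t. l i t b) t\<bar> \<le> wt R h"
  using assms(3-)
proof (induction h arbitrary: i b t rule: less_induct)
  case (less h)
  show ?case
  proof (cases "h = 0")
    case True
    then show ?thesis using l_bounds[OF less.prems(2,3), of t] by (simp add: wt_def)
  next
    case False
    \<comment> \<open>\<open>96 = 8 * 3 * 4\<close>: the normalisation of the window norm, the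
      coefficients of \<open>2 * l - l'\<close>, and \<open>wt_Suc\<close>. The Gibbs ratio costs a
      further 8, whence the 768 in the hypothesis.\<close>
    define \<beta> where "\<beta> = 96 * \<eta> * R"
    define J where "J = {1..n} - {i}"
    \<comment> \<open>Exponents relative to time \<open>t\<close>, so \<open>f j a 0 = 0\<close>.
      Order 0 of the window is then a sum of at most \<open>h\<close> increments of size
      \<open>2 * \<eta>\<close>, controlled by \<open>h \<le> R\<close>.\<close>
    define f where "f j a s = - \<eta> * ((U j (t - 1 + s) a + l j (t - 1 + s) a) - (U j (t - 1) a + l j (t - 1) a))" for j a s
    define u where "u j a s = exp (f j a s) / (\<Sum>c\<in>A j. x t j c * exp (f j c s)) - 1" for j a s
    have t: "t \<ge> Suc h" "t \<ge> 1" using less.prems by auto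
    have n: "real n \<ge> 1" using game by (simp add: is_game_def)
    have \<gamma>: "0 \<le> 8 * \<beta>" "real n * (8 * \<beta>)\<^sup>2 \<le> 1" using R(1,2) \<eta> by (auto simp: \<beta>_def algebra_simps)
    have "(8 * \<beta>)\<^sup>2 \<le> 1"
      using \<gamma>(2) mult_right_mono[OF n, of "(8 * \<beta>)\<^sup>2"] by simp
    then have \<beta>: "\<beta> \<le> 1 / 8" using \<gamma>(1) power_le_one_iff[of "8 * \<beta>" 2] by simp
    have J: "finite J" "j \<in> J \<Longrightarrow> j \<in> {1..n}" for j by (auto simp: J_def)

    have fnorm: "window_norm R h (f j a) \<le> \<beta>" if j: "j \<in> {1..n}" and a: "a \<in> A j" for j a
      unfolding window_norm_le_iff[OF R(1)]
    proof (intro allI impI)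
      fix k s assume ks: "k + s \<le> h"
      have fd: "fdiff (f j a) s = - \<eta> * (2 * l j (t + s) a - l j (t - 1 + s) a)" for s
      proof -
        obtain t' where "t = Suc t'" using t by (cases t) auto
        then show ?thesis by (simp add: fdiff_def f_def U_def algebra_simps)
      qed
      show "\<bar>fdiffs k (f j a) s\<bar> \<le> \<beta> / 8 * wt R k"
      proof (cases k)
        case 0
        have "\<bar>f j a s\<bar> \<le> 2 * \<eta> * real s" for s
        proof (induction s)
          case 0
          show ?case by (simp add: f_def)
        next
          case (Suc s)
          have "\<bar>2 * l j (t + s) a - l j (t - 1 + s) a\<bar> \<le> 2"
            using l_bounds[OF j a, of "t + s"] l_bounds[OF j a, of "t - 1 + s"] by auto
          then have "\<bar>fdiff (f j a) s\<bar> \<le> \<eta> * 2"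
            unfolding fd abs_mult using \<eta> by (intro mult_mono) auto
          then show ?case using Suc by (simp add: fdiff_def algebra_simps)
        qed
        from this[of s] have "\<bar>f j a s\<bar> \<le> 2 * \<eta> * real s" .
        also have "\<dots> \<le> 2 * \<eta> * R" using ks less.prems(1) \<eta> by (intro mult_left_mono) auto
        also have "\<dots> \<le> \<beta> / 8 * wt R 0" using \<eta> R(1) by (simp add: \<beta>_def wt_def)
        finally show ?thesis using 0 by simp
      next
        \<comment> \<open>One difference turns the cumulative losses in \<open>f\<close> back into
          losses. So order \<open>k \<le> h\<close> of \<open>f\<close> only involves order
          \<open>k' < h\<close> of the losses, where the induction hypothesis applies.\<close>
        case (Suc k')
        have IH: "\<bar>fdiffs k' (\<lambda>t. l j t a) r\<bar> \<le> wt R k'" if "r \<ge> Suc k'" for r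
          using less.IH[of k' j a r] Suc ks less.prems(1) j a that by auto
        have "fdiffs k (f j a) s = fdiffs k' (fdiff (f j a)) s"
          unfolding Suc fdiffs_Suc_fdiff ..
        also have "fdiff (f j a) = (\<lambda>s. - \<eta> * (2 * l j (t + s) a - l j (t - 1 + s) a))"
          by (rule ext) (rule fd)
        also have "fdiffs k' \<dots> s = - \<eta> * (2 * fdiffs k' (\<lambda>t. l j t a) (t + s) - fdiffs k' (\<lambda>t. l j t a) (t - 1 + s))"
          unfolding fdiffs_cmult fdiffs_diff using fdiffs_shift[of k' "\<lambda>t. l j t a"] by simp
        also have "\<bar>\<dots>\<bar> \<le> \<eta> * (3 * wt R k')"
        proof -
          have "\<bar>2 * fdiffs k' (\<lambda>t. l j t a) (t + s) - fdiffs k' (\<lambda>t. l j t a) (t - 1 + s)\<bar> \<le> 3 * wt R k'"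
          proof -
            have "Suc k' \<le> t + s" "Suc k' \<le> t - 1 + s" using t Suc ks by auto
            from IH[OF this(1)] IH[OF this(2)] show ?thesis by arith
          qed
          then show ?thesis unfolding abs_mult using \<eta> by (intro mult_mono) auto
        qed
        also have "\<dots> \<le> \<eta> * (3 * (4 * R * wt R k))"
          unfolding Suc using wt_Suc[OF R(1)] \<eta> by (intro mult_left_mono) auto
        also have "\<dots> = \<beta> / 8 * wt R k" by (simp add: \<beta>_def)
        finally show ?thesis .
      qed
    qed

    have xts: "x (t + s) j a = x t j a * (1 + u j a s)" if j: "j \<in> {1..n}" and a: "a \<in> A j" for j a s
    proof -
      let ?V = "\<lambda>t a. - \<eta> * (U j t a + l j t a)"
      have 1: "x (t + s) j c = softmax (A j) (?V (t - 1 + s)) c" "x t j c = softmax (A j) (?V (t - 1)) c"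
        if "c \<in> A j" for c
        using x_eq_softmax[OF j that, of "t - 1 + s"] x_eq_softmax[OF j that, of "t - 1"] t by auto
      have 2: "x t j c * exp (f j c s) = exp (?V (t - 1 + s) c) / (\<Sum>b\<in>A j. exp (?V (t - 1) b))"
        if "c \<in> A j" for c
        using that unfolding 1(2)[OF that] softmax_def f_def
        by (simp add: exp_add[symmetric] algebra_simps)
      have "x t j a * (1 + u j a s) = x t j a * exp (f j a s) / (\<Sum>c\<in>A j. x t j c * exp (f j c s))"
        by (simp add: u_def)
      also have "\<dots> = softmax (A j) (?V (t - 1 + s)) a"
        using 2 a sum_exp_pos[OF _ A_ne[OF j], of "?V (t - 1)"]
        by (simp add: softmax_def sum_divide_distrib[symmetric])
      finally show ?thesis using 1(1)[OF a] by simp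
    qed

    have unorm: "window_norm R h (u j a) \<le> 8 * \<beta>" if j: "j \<in> J" and a: "a \<in> A j" for j a
      unfolding u_def using is_distD[OF is_dist_x[OF J(2)[OF j] t(2)]] fnorm[OF J(2)[OF j]] \<beta> a
      by (intro window_norm_softmax_ratio[OF R(1)]) auto
    have u0: "(\<Sum>a\<in>A j. x t j a * u j a s) = 0" if j: "j \<in> J" for j s
    proof -
      have "(\<Sum>a\<in>A j. x t j a * u j a s) = (\<Sum>a\<in>A j. x (t + s) j a - x t j a)"
        using xts[OF J(2)[OF j]] by (intro sum.cong) (auto simp: algebra_simps)
      also have "\<dots> = 0"
        using is_distD(3)[OF is_dist_x[OF J(2)[OF j]], of t] is_distD(3)[OF is_dist_x[OF J(2)[OF j]], of "t + s"] t
        by (simp add: sum_subtractf)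
      finally show ?thesis .
    qed

    have "fdiffs h (\<lambda>t. l i t b) t = fdiffs h (\<lambda>s. l i (t + s) b) 0"
      using fdiffs_shift[of h "\<lambda>t. l i t b" t 0] by simp
    also have "(\<lambda>s. l i (t + s) b) = (\<lambda>s. \<Sum>a\<in>PiE J A. L i (a(i := b)) * (\<Prod>j\<in>J. x t j (a j) * (1 + u j (a j) s)))"
    proof
      fix s
      have "(\<Prod>j\<in>J. x (t + s) j (a j)) = (\<Prod>j\<in>J. x t j (a j) * (1 + u j (a j) s))" if "a \<in> PiE J A" for a
        using xts J(2) PiE_mem[OF that] by (intro prod.cong refl) blast
      then show "l i (t + s) b = (\<Sum>a\<in>PiE J A. L i (a(i := b)) * (\<Prod>j\<in>J. x t j (a j) * (1 + u j (a j) s)))"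
        using t by (subst l_eq) (auto simp only: J_def[symmetric] intro!: sum.cong)
    qed
    finally have eq: "fdiffs h (\<lambda>t. l i t b) t = fdiffs h (\<lambda>s. \<Sum>a\<in>PiE J A. L i (a(i := b)) *
        (\<Prod>j\<in>J. x t j (a j) * (1 + u j (a j) s))) 0" .
    have "(fdiffs h (\<lambda>t. l i t b) t)\<^sup>2 \<le> (wt R h / 8)\<^sup>2 * ((1 + (8 * \<beta>)\<^sup>2) ^ card J - 1)"
      unfolding eq
    proof (rule fdiffs_product_mean_le[OF R(1) _ J(1)])
      show "\<bar>L i (a(i := b))\<bar> \<le> 1" if "a \<in> PiE J A" for a
        using that L_bounds[OF less.prems(2) fun_upd_in_profiles[OF less.prems(2,3)], of a]
        by (simp add: profiles_without_def J_def)
      show "is_dist (A j) (x t j)" if "j \<in> J" for j using J(2)[OF that] t(2) by (rule is_dist_x)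
    qed (use False u0 unorm \<gamma>(1) in auto)
    also have "(1 + (8 * \<beta>)\<^sup>2) ^ card J \<le> exp ((8 * \<beta>)\<^sup>2) ^ n"
    proof -
      have "(1 + (8 * \<beta>)\<^sup>2) ^ card J \<le> (1 + (8 * \<beta>)\<^sup>2) ^ n"
        using card_mono[of "{1..n}" J] by (intro power_increasing) (auto simp: J_def)
      also have "\<dots> \<le> exp ((8 * \<beta>)\<^sup>2) ^ n"
        by (intro power_mono exp_ge_add_one_self) auto
      finally show ?thesis .
    qed
    also have "exp ((8 * \<beta>)\<^sup>2) ^ n \<le> 3"
    proof -
      have "exp ((8 * \<beta>)\<^sup>2) ^ n = exp (real n * (8 * \<beta>)\<^sup>2)" by (simp add: exp_of_nat_mult)
      also have "\<dots> \<le> exp 1" using \<gamma>(2) by simp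
      also have "\<dots> \<le> 3" by (rule exp_le)
      finally show ?thesis .
    qed
    also have "(wt R h / 8)\<^sup>2 * (3 - 1) \<le> (wt R h)\<^sup>2"
      by (simp add: power2_eq_square)
    finally have "(fdiffs h (\<lambda>t. l i t b) t)\<^sup>2 \<le> (wt R h)\<^sup>2" by (simp add: mult_left_mono)
    then show ?thesis using wt_pos[OF R(1), of h] by (metis abs_le_square_iff abs_of_pos)
  qed
qed

end

section \<open>Regret in self-play and the equilibrium gap\<close>

lemma abs_diff_le_of_ratio:
  fixes u v :: real
  assumes "0 \<le> u" "0 \<le> v" "v \<le> K * u" "u \<le> K * v" "K \<ge> 1"
  shows "\<bar>v - u\<bar> \<le> (K - 1) * u" "\<bar>v - u\<bar> \<le> (K - 1) * v"
proof -
  have 1: "v - u \<le> (K - 1) * u" "u - v \<le> (K - 1) * v" using assms by (auto simp: algebra_simps)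
  have "v \<le> u \<Longrightarrow> (K - 1) * v \<le> (K - 1) * u" "u \<le> v \<Longrightarrow> (K - 1) * u \<le> (K - 1) * v"
    using assms by (auto intro: mult_left_mono)
  moreover have "0 \<le> (K - 1) * u" "0 \<le> (K - 1) * v" using assms by auto
  ultimately show "\<bar>v - u\<bar> \<le> (K - 1) * u" "\<bar>v - u\<bar> \<le> (K - 1) * v" using 1 by linarith+
qed

lemma wt_le_power:
  assumes "R > 0" "k \<le> H"
  shows "wt R k \<le> (real H / R) ^ k"
proof -
  have "fact k \<le> real H ^ k"
  proof -
    have "fact k \<le> real k ^ k" using fact_le_power[of k] by simp
    also have "\<dots> \<le> real H ^ k" using assms by (intro power_mono) auto
    finally show ?thesis .
  qed
  moreover have "fact k / (R ^ k * (real k + 1)\<^sup>2) \<le> fact k / (R ^ k * 1)"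
    using assms by (intro divide_left_mono mult_left_mono) auto
  ultimately show ?thesis using assms
    by (simp add: wt_def power_divide) (meson divide_right_mono less_imp_le order_trans zero_less_power)
qed

context optimistic_hedge_game
begin

text \<open>The exponent \<open>2 * l (Suc t) - l t\<close> lies in \<open>[-1, 2]\<close>, and the
  normaliser is a mean over the same range. Their quotient is governed by the length 3 of this
  interval.\<close>

lemma x_ratio:
  assumes i: "i \<in> {1..n}" and a: "a \<in> A i"
  shows "x (Suc (Suc t)) i a \<le> exp (3 * \<eta>) * x (Suc t) i a"
    "x (Suc t) i a \<le> exp (3 * \<eta>) * x (Suc (Suc t)) i a"
proof -
  let ?v = "\<lambda>a. 2 * l i (Suc t) a - l i t a"
  let ?e = "\<lambda>a. exp (- \<eta> * ?v a)"
  have p: "is_dist (A i) (x (Suc t) i)" using i by (intro is_dist_x) auto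
  have eq: "x (Suc (Suc t)) i a = x (Suc t) i a * ?e a / mean (A i) (x (Suc t) i) ?e"
    using play i a unfolding optimistic_hedge_play_def mean_def l_def by simp
  have e: "exp (- 2 * \<eta>) \<le> ?e b \<and> ?e b \<le> exp \<eta>" if "b \<in> A i" for b
  proof -
    have "-1 \<le> ?v b" "?v b \<le> 2" using l_bounds[OF i that, of t] l_bounds[OF i that, of "Suc t"] by auto
    then have "\<eta> * -1 \<le> \<eta> * ?v b" "\<eta> * ?v b \<le> \<eta> * 2" using \<eta> by (auto simp only: mult_left_mono less_imp_le)
    then show ?thesis by auto
  qed
  let ?m = "mean (A i) (x (Suc t) i) ?e"
  have m: "exp (- 2 * \<eta>) \<le> ?m" "?m \<le> exp \<eta>"
    using mean_bounds[OF p, of "exp (- 2 * \<eta>)" ?e "exp \<eta>"] e by auto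
  then have mpos: "?m > 0" by (meson exp_gt_zero less_le_trans)
  have x0: "x (Suc t) i a > 0" using x_pos i a by simp
  have "?e a \<le> exp (3 * \<eta>) * exp (- 2 * \<eta>)" using e[OF a] by (simp add: exp_add[symmetric])
  also have "\<dots> \<le> exp (3 * \<eta>) * ?m" using m by (intro mult_left_mono) auto
  finally have "?e a / ?m \<le> exp (3 * \<eta>)" using mpos by (simp add: divide_le_eq)
  from mult_left_mono[OF this, of "x (Suc t) i a"] x0
  show "x (Suc (Suc t)) i a \<le> exp (3 * \<eta>) * x (Suc t) i a" by (simp add: eq mult.commute)
  have "?m \<le> exp (3 * \<eta>) * exp (- 2 * \<eta>)" using m by (simp add: exp_add[symmetric])
  also have "\<dots> \<le> exp (3 * \<eta>) * ?e a" using e[OF a] by (intro mult_left_mono) auto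
  finally have "1 \<le> exp (3 * \<eta>) * (?e a / ?m)" using mpos by (simp add: le_divide_eq)
  from mult_left_mono[OF this, of "x (Suc t) i a"] x0
  show "x (Suc t) i a \<le> exp (3 * \<eta>) * x (Suc (Suc t)) i a" by (simp add: eq mult_ac)
qed

text \<open>Each pair of actions is a scalar interpolation problem with weight
  \<open>x a * x b\<close>; both factors change by at most \<open>exp (3 * \<eta>)\<close> per
  round, hence the \<open>6 * \<eta>\<close>. In every round the weights of all pairs sum to 1, so
  the number of actions does not enter: the errors are \<open>16 * 2\<close> at the boundary plus at
  most 4, and half of 36 is 18.\<close>

lemma variation_le_variance:
  assumes R: "R > 0" "real n * (768 * \<eta> * R)\<^sup>2 \<le> 1" "real H \<le> R"
    and H: "H > 0" "4 * (real H / R) \<le> 1" "exp (6 * \<eta> * real H) * (1 + 4 * (real H / R)) \<le> 3 / 2"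
    and i: "i \<in> {1..n}" and T: "Suc H \<le> T" "real T \<le> 16 ^ H"
  shows "(\<Sum>t\<in>{Suc H..<T}. var (A i) (x (Suc t) i) (\<lambda>a. l i (Suc t) a - l i t a))
    \<le> (\<Sum>t\<in>{Suc H..<T}. var (A i) (x (Suc t) i) (l i t)) / 4 + 18"
proof -
  define \<delta> where "\<delta> = real H / R"
  \<comment> \<open>The index is \<open>Suc t\<close> because the regret bound takes the variance of
    \<open>l t\<close> under the next strategy; it also keeps the unconstrained \<open>x 0\<close>
    out.\<close>
  define w where "w a b t = x (Suc t) i a * x (Suc t) i b" for a b t
  define g where "g a b t = l i t a - l i t b" for a b t
  have \<delta>: "\<delta> > 0" using R H by (simp add: \<delta>_def)
  have x0: "x (Suc t) i a > 0" if "a \<in> A i" for a t using x_pos i that by simp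
  have xd: "is_dist (A i) (x (Suc t) i)" for t using i by (intro is_dist_x) auto
  have E: "energy (w a b) (Suc H) T (fdiff (g a b)) \<le> energy (w a b) (Suc H) T (g a b) / 4
     + 16 * (w a b (Suc H) + w a b T) + 4 / 16 ^ H * (\<Sum>t\<in>{Suc H..<T}. w a b t)"
    if a: "a \<in> A i" and b: "b \<in> A i" for a b
  proof (rule energy_fdiff_le_energy[where \<kappa> = "exp (6 * \<eta>) - 1" and \<delta> = \<delta>])
    have w0: "w a b t > 0" for t using x0 a b by (simp add: w_def)
    then show "0 \<le> w a b t" for t by (simp add: less_imp_le)
    have e6: "exp (6 * \<eta>) = exp (3 * \<eta>) * exp (3 * \<eta>)" by (simp add: exp_add[symmetric])
    have w1: "w a b (Suc t) \<le> exp (6 * \<eta>) * w a b t" for t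
    proof -
      have "w a b (Suc t) \<le> (exp (3 * \<eta>) * x (Suc t) i a) * (exp (3 * \<eta>) * x (Suc t) i b)"
        unfolding w_def using x0 a b by (intro mult_mono x_ratio i) (auto simp: less_imp_le)
      then show ?thesis unfolding w_def e6 by (simp only: mult_ac)
    qed
    have w2: "w a b t \<le> exp (6 * \<eta>) * w a b (Suc t)" for t
    proof -
      have "w a b t \<le> (exp (3 * \<eta>) * x (Suc (Suc t)) i a) * (exp (3 * \<eta>) * x (Suc (Suc t)) i b)"
        unfolding w_def using x0 a b by (intro mult_mono x_ratio i) (auto simp: less_imp_le)
      then show ?thesis unfolding w_def e6 by (simp only: mult_ac)
    qed
    have e1: "1 \<le> exp (6 * \<eta>)" using \<eta> by simp
    show "\<bar>w a b (Suc t) - w a b t\<bar> \<le> (exp (6 * \<eta>) - 1) * w a b t"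
      "\<bar>w a b (Suc t) - w a b t\<bar> \<le> (exp (6 * \<eta>) - 1) * w a b (Suc t)" for t
      using abs_diff_le_of_ratio[OF _ _ w1 w2 e1] w0 by (auto simp: less_imp_le)
    show "0 \<le> exp (6 * \<eta>) - 1" using e1 by simp
    have "(1 + (exp (6 * \<eta>) - 1)) ^ H = exp (6 * \<eta> * real H)"
      by (simp add: exp_of_nat_mult[symmetric] mult.commute)
    then show "(1 + (exp (6 * \<eta>) - 1)) ^ H * (1 + 4 * \<delta>) - 1 \<le> 1 / 2" using H(3) by (simp add: \<delta>_def)
    show "\<bar>fdiffs k (g a b) t\<bar> \<le> 2 * \<delta> ^ k" if "k \<le> H" "Suc H \<le> t" for k t
    proof -
      have "\<bar>fdiffs k (\<lambda>t. l i t c) t\<bar> \<le> \<delta> ^ k" if c: "c \<in> A i" for c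
      proof -
        have "\<bar>fdiffs k (\<lambda>t. l i t c) t\<bar> \<le> wt R k"
          using \<open>k \<le> H\<close> \<open>Suc H \<le> t\<close> R c i by (intro fdiffs_l_le) auto
        also have "\<dots> \<le> \<delta> ^ k" unfolding \<delta>_def using \<open>k \<le> H\<close> R(1) by (intro wt_le_power)
        finally show ?thesis .
      qed
      from this[OF a] this[OF b] show ?thesis unfolding g_def fdiffs_diff by arith
    qed
  qed (use \<delta> H T in \<open>auto simp: \<delta>_def\<close>)
  have sw: "(\<Sum>a\<in>A i. \<Sum>b\<in>A i. w a b t) = 1" for t
    unfolding w_def sum_product[symmetric] is_distD(3)[OF xd] by simp
  have en: "(\<Sum>t\<in>{Suc H..<T}. var (A i) (x (Suc t) i) (f t))
      = (\<Sum>a\<in>A i. \<Sum>b\<in>A i. energy (w a b) (Suc H) T (\<lambda>t. f t a - f t b)) / 2" for f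
  proof -
    have "(\<Sum>t\<in>{Suc H..<T}. var (A i) (x (Suc t) i) (f t))
      = (\<Sum>t\<in>{Suc H..<T}. \<Sum>a\<in>A i. \<Sum>b\<in>A i. w a b t * (f t a - f t b)\<^sup>2) / 2"
      by (simp only: var_eq_pairs[OF xd] w_def sum_divide_distrib)
    also have "(\<Sum>t\<in>{Suc H..<T}. \<Sum>a\<in>A i. \<Sum>b\<in>A i. w a b t * (f t a - f t b)\<^sup>2)
      = (\<Sum>a\<in>A i. \<Sum>b\<in>A i. energy (w a b) (Suc H) T (\<lambda>t. f t a - f t b))"
      unfolding energy_def by (subst sum.swap) (intro sum.cong refl sum.swap)
    finally show ?thesis .
  qed
  have "(\<Sum>a\<in>A i. \<Sum>b\<in>A i. energy (w a b) (Suc H) T (fdiff (g a b)))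
    \<le> (\<Sum>a\<in>A i. \<Sum>b\<in>A i. energy (w a b) (Suc H) T (g a b) / 4
     + 16 * (w a b (Suc H) + w a b T) + 4 / 16 ^ H * (\<Sum>t\<in>{Suc H..<T}. w a b t))"
    by (intro sum_mono E)
  also have "\<dots> = (\<Sum>a\<in>A i. \<Sum>b\<in>A i. energy (w a b) (Suc H) T (g a b)) / 4 + 32
      + 4 / 16 ^ H * (\<Sum>a\<in>A i. \<Sum>b\<in>A i. \<Sum>t\<in>{Suc H..<T}. w a b t)"
    unfolding sum.distrib sum_distrib_left[symmetric] sw by (simp add: sum_divide_distrib)
  also have "(\<Sum>a\<in>A i. \<Sum>b\<in>A i. \<Sum>t\<in>{Suc H..<T}. w a b t) = (\<Sum>t\<in>{Suc H..<T}. \<Sum>a\<in>A i. \<Sum>b\<in>A i. w a b t)"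
    by (subst (2) sum.swap) (intro sum.cong refl sum.swap)
  also have "\<dots> = real (T - Suc H)" unfolding sw by simp
  also have "4 / 16 ^ H * real (T - Suc H) \<le> 4 / 16 ^ H * 16 ^ H"
    by (intro mult_left_mono order_trans[OF _ T(2)] of_nat_mono) auto
  finally have fin: "(\<Sum>a\<in>A i. \<Sum>b\<in>A i. energy (w a b) (Suc H) T (fdiff (g a b)))
    \<le> (\<Sum>a\<in>A i. \<Sum>b\<in>A i. energy (w a b) (Suc H) T (g a b)) / 4 + 36" by simp
  have "fdiff (g a b) = (\<lambda>t. (l i (Suc t) a - l i t a) - (l i (Suc t) b - l i t b))" for a b
    by (simp add: fun_eq_iff fdiff_def g_def)
  then show ?thesis using fin unfolding en g_def by simp
qed

lemma regret_le:
  assumes R: "R > 0" "real n * (768 * \<eta> * R)\<^sup>2 \<le> 1" "real H \<le> R"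
    and H: "H > 0" "4 * (real H / R) \<le> 1" "exp (6 * \<eta> * real H) * (1 + 4 * (real H / R)) \<le> 3 / 2"
    and i: "i \<in> {1..n}" and T: "real T \<le> 16 ^ H" and \<eta>4: "\<eta> \<le> 1 / 4" and b: "b \<in> A i"
  shows "(\<Sum>t\<in>{1..T}. mean (A i) (x t i) (l i t) - l i t b) \<le> ln (d i) / \<eta> + \<eta> * (4 * real H + 22)"
proof -
  \<comment> \<open>The play determines \<open>x\<close> on \<open>A i\<close> only, whereas the
    regret lemma asks for an equality of functions; \<open>X\<close> is the softmax itself.\<close>
  define X where "X t = softmax (A i) (\<lambda>b. - \<eta> * (U i (t - 1) b + l i (t - 1) b))" for t
  have Xx: "X (Suc t) a = x (Suc t) i a" if "a \<in> A i" for t a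
    using x_eq_softmax[OF i that] by (simp add: X_def)
  have mX: "mean (A i) (X (Suc t)) v = mean (A i) (x (Suc t) i) v" for t v
    unfolding mean_def using Xx by (intro sum.cong) auto
  have vX: "var (A i) (X (Suc t)) v = var (A i) (x (Suc t) i) v" for t v
    unfolding var_def mX using Xx by (intro sum.cong) auto
  have xd: "is_dist (A i) (x (Suc t) i)" for t using i by (intro is_dist_x) auto
  define v where "v t = var (A i) (x (Suc t) i) (\<lambda>a. l i (Suc t) a - l i t a)" for t
  define e where "e t = var (A i) (x (Suc t) i) (l i t)" for t
  have e0: "e t \<ge> 0" for t unfolding e_def by (rule var_nonneg[OF xd])
  have v4: "v t \<le> 4" for t
  proof -
    have "v t \<le> (1 - (- 1))\<^sup>2" unfolding v_def
    proof (rule var_le[OF xd])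
      show "- 1 \<le> l i (Suc t) a - l i t a \<and> l i (Suc t) a - l i t a \<le> 1" if "a \<in> A i" for a
        using l_bounds[OF i that, of t] l_bounds[OF i that, of "Suc t"] by auto
    qed
    then show ?thesis by simp
  qed
  have "(\<Sum>t<T. mean (A i) (X (Suc t)) (l i (Suc t))) - U i T b \<le> ln (card (A i)) / \<eta>
     + (\<Sum>t<T. \<eta> * var (A i) (X (Suc t)) (\<lambda>a. l i (Suc t) a - l i t a) - \<eta> / 4 * var (A i) (X (Suc t)) (l i t))"
    using \<eta> \<eta>4 b l_bounds[OF i] by (intro optimistic_hedge_regret) (auto simp: U_def X_def fun_eq_iff)
  then have 1: "(\<Sum>t<T. mean (A i) (x (Suc t) i) (l i (Suc t))) - U i T b \<le> ln (d i) / \<eta>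
     + \<eta> * (\<Sum>t<T. v t - e t / 4)"
    unfolding mX vX v_def e_def by (simp add: sum_distrib_left right_diff_distrib)
  have 2: "(\<Sum>t<T. v t - e t / 4) \<le> 4 * real H + 22"
  proof (cases "Suc H \<le> T")
    case True
    have "(\<Sum>t<T. v t - e t / 4) = (\<Sum>t<Suc H. v t - e t / 4) + (\<Sum>t\<in>{Suc H..<T}. v t - e t / 4)"
      using True by (simp only: lessThan_atLeast0) (rule sum.atLeastLessThan_concat[symmetric], auto)
    also have "(\<Sum>t<Suc H. v t - e t / 4) \<le> (\<Sum>t<Suc H. 4)"
      using e0 v4 by (intro sum_mono) (smt (verit) divide_nonneg_pos)
    also have "(\<Sum>t\<in>{Suc H..<T}. v t - e t / 4) \<le> 18"
      using variation_le_variance[OF R H i True T] unfolding v_def[symmetric] e_def[symmetric]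
      by (simp add: sum_subtractf sum_divide_distrib)
    finally show ?thesis by simp
  next
    case False
    have "(\<Sum>t<T. v t - e t / 4) \<le> (\<Sum>t<T. 4)"
      using e0 v4 by (intro sum_mono) (smt (verit) divide_nonneg_pos)
    also have "\<dots> \<le> 4 * real H + 22" using False by simp
    finally show ?thesis .
  qed
  have "(\<Sum>t\<in>{1..T}. mean (A i) (x t i) (l i t) - l i t b)
     = (\<Sum>t<T. mean (A i) (x (Suc t) i) (l i (Suc t))) - U i T b"
  proof -
    have "(\<Sum>t\<in>{1..T}. f t) = (\<Sum>t<T. f (Suc t))" for f :: "nat \<Rightarrow> real"
      by (simp add: sum.atLeast_Suc_atMost_Suc_shift atLeast0LessThan sum.atLeast1_atMost_eq)
    then show ?thesis by (simp add: sum_subtractf U_def)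
  qed
  also have "\<dots> \<le> ln (d i) / \<eta> + \<eta> * (\<Sum>t<T. v t - e t / 4)" by (rule 1)
  also have "\<dots> \<le> ln (d i) / \<eta> + \<eta> * (4 * real H + 22)"
    using 2 \<eta> by (intro add_left_mono mult_left_mono) auto
  finally show ?thesis .
qed

section \<open>From regret to the equilibrium gap\<close>

lemma sum_profiles:
  assumes i: "i \<in> {1..n}"
  shows "(\<Sum>a\<in>profiles n d. f a) = (\<Sum>c\<in>A i. \<Sum>a\<in>profiles_without n d i. f (a(i := c)) :: real)"
proof -
  let ?J = "{1..n} - {i}"
  have "profiles n d = (\<lambda>(c, a). a(i := c)) ` (A i \<times> PiE ?J A)"
    using PiE_insert_eq[of i ?J A] i by (simp add: profiles_def insert_absorb)
  moreover have "inj_on (\<lambda>(c, a). a(i := c)) (A i \<times> PiE ?J A)"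
    by (rule inj_combinator) auto
  ultimately show ?thesis
    by (simp add: sum.reindex sum.cartesian_product profiles_without_def case_prod_unfold)
qed

text \<open>Under a product distribution the cost of deviating to \<open>b\<close> does not depend
  on the player's own action, so it is \<open>l i t b\<close>. By linearity in the distribution, the
  gain from a deviation under average play is an average regret.\<close>

lemma sum_product_dist:
  assumes i: "i \<in> {1..n}" and t: "t \<ge> 1"
  shows "(\<Sum>a\<in>profiles n d. product_dist n (x t) a * (L i a - L i (a(i := b))))
     = mean (A i) (x t i) (l i t) - l i t b"
proof -
  let ?J = "{1..n} - {i}"
  have pd: "product_dist n (x t) (a(i := c)) = x t i c * (\<Prod>j\<in>?J. x t j (a j))" for a c
  proof -
    have "product_dist n (x t) (a(i := c)) = x t i c * (\<Prod>j\<in>?J. x t j ((a(i := c)) j))"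
      unfolding product_dist_def using i by (subst prod.remove[of _ i]) auto
    also have "(\<Prod>j\<in>?J. x t j ((a(i := c)) j)) = (\<Prod>j\<in>?J. x t j (a j))"
      by (intro prod.cong) auto
    finally show ?thesis .
  qed
  have "(\<Sum>a\<in>profiles n d. product_dist n (x t) a * (L i a - L i (a(i := b))))
    = (\<Sum>c\<in>A i. x t i c * l i t c - x t i c * l i t b)"
    unfolding sum_profiles[OF i] pd l_eq[OF t] profiles_without_def sum_distrib_left sum_subtractf[symmetric]
    by (intro sum.cong refl) (simp add: algebra_simps)
  then show ?thesis
    using is_distD(3)[OF is_dist_x[OF i t]] by (simp add: sum_subtractf mean_def flip: sum_distrib_right)
qed

lemma sum_average_play:
  assumes "i \<in> {1..n}"
  shows "(\<Sum>a\<in>profiles n d. average_play n T x a * (L i a - L i (a(i := b))))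
     = (\<Sum>t\<in>{1..T}. mean (A i) (x t i) (l i t) - l i t b) / real T"
proof -
  have "(\<Sum>a\<in>profiles n d. average_play n T x a * (L i a - L i (a(i := b))))
    = (\<Sum>t\<in>{1..T}. \<Sum>a\<in>profiles n d. product_dist n (x t) a * (L i a - L i (a(i := b)))) / real T"
    unfolding average_play_def sum_divide_distrib sum_distrib_left sum_distrib_right
    by (subst sum.swap) simp
  then show ?thesis using sum_product_dist[OF assms] by simp
qed

lemma Gap_CCE_le:
  assumes "\<And>i b. i \<in> {1..n} \<Longrightarrow> b \<in> A i \<Longrightarrow> (\<Sum>t\<in>{1..T}. mean (A i) (x t i) (l i t) - l i t b) \<le> B"
  shows "Gap_CCE n d L (average_play n T x) \<le> B / real T"
proof -
  have "n \<ge> 1" using game by (simp add: is_game_def)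
  then show ?thesis unfolding Gap_CCE_def using A_ne assms
    by (subst Max_le_iff) (auto simp: sum_average_play intro!: divide_right_mono)
qed

text \<open>With one action \<open>ln (d i) = 0\<close>, so no additive constant can be absorbed and
  the regret has to vanish exactly.\<close>

lemma regret_one_action:
  assumes i: "i \<in> {1..n}" and b: "b \<in> A i" and "d i = 1"
  shows "(\<Sum>t\<in>{1..T}. mean (A i) (x t i) (l i t) - l i t b) = 0"
proof -
  have "A i = {b}" using b \<open>d i = 1\<close> by auto
  then have "mean (A i) (x t i) (l i t) = l i t b" if "t \<ge> 1" for t
    using is_distD(3)[OF is_dist_x[OF i that]] by (simp add: mean_def)
  then show ?thesis by simp
qed

end

theorem corollary4p3:
  "\<exists>c C :: real. c > 0 \<and> C > 0 \<and>
     (\<forall>(n :: nat) (d :: nat \<Rightarrow> nat) (L :: nat \<Rightarrow> (nat \<Rightarrow> nat) \<Rightarrow> real) (T :: nat)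
        (x :: nat \<Rightarrow> nat \<Rightarrow> nat \<Rightarrow> real).
        is_game n d L \<longrightarrow> T \<ge> 1 \<longrightarrow>
        optimistic_hedge_play n d L (c / (sqrt (real n) * ln (real T + 2))) x \<longrightarrow>
        Gap_CCE n d L (average_play n T x)
          \<le> C * sqrt (real n) * ln (real (MAX i\<in>{1..n}. d i)) * ln (real T + 2) / real T)"
proof -
  \<comment> \<open>\<open>61440 = 768 * 80\<close>, which makes \<open>R = 80 * \<tau>\<close>;
    with \<open>H \<le> 2 * \<tau>\<close> the decay rate \<open>H / R\<close> is at most
    1/40.\<close>
  define c :: real where "c = 1 / 61440"
  have "Gap_CCE n d L (average_play n T x)
      \<le> (3 / c) * sqrt (real n) * ln (real (MAX i\<in>{1..n}. d i)) * ln (real T + 2) / real T"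
    if game: "is_game n d L" and "T \<ge> 1"
      and play: "optimistic_hedge_play n d L (c / (sqrt (real n) * ln (real T + 2))) x"
    for n d L T x
  proof -
    define \<tau> where "\<tau> = ln (real T + 2)"
    define \<eta> where "\<eta> = c / (sqrt (real n) * \<tau>)"
    define R where "R = \<tau> / (768 * c)"
    \<comment> \<open>Since \<open>exp \<tau> = T + 2\<close>, this order gives
      \<open>T \<le> exp H \<le> 16 ^ H\<close>. Rounding up at most doubles \<open>\<tau>\<close>,
      because \<open>T + 2 \<ge> 3\<close> forces \<open>\<tau> \<ge> 1\<close>.\<close>
    define H where "H = nat \<lceil>\<tau>\<rceil>"
    define D where "D = (MAX i\<in>{1..n}. d i)"
    have n: "n \<ge> 1" using game by (simp add: is_game_def)
    then have sn: "sqrt (real n) \<ge> 1" by simp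
    have \<tau>: "\<tau> \<ge> 1"
    proof -
      have "exp 1 \<le> real T + 2" using exp_le \<open>T \<ge> 1\<close> by linarith
      then show ?thesis unfolding \<tau>_def by (subst ln_ge_iff) auto
    qed
    have c: "c > 0" by (simp add: c_def)
    have s\<tau>: "sqrt (real n) * \<tau> \<ge> 1" using mult_mono[OF sn \<tau>] by simp
    have \<eta>0: "\<eta> > 0" and \<eta>c: "\<eta> \<le> c"
      using c s\<tau> by (auto simp: \<eta>_def divide_le_eq intro!: divide_pos_pos)
    have \<eta>\<tau>: "\<eta> * \<tau> \<le> c"
    proof -
      have "\<eta> * \<tau> = c / sqrt (real n)" using \<tau> by (simp add: \<eta>_def)
      also have "\<dots> \<le> c / 1" using sn c by (intro divide_left_mono) auto
      finally show ?thesis by simp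
    qed
    interpret optimistic_hedge_game n d L \<eta> x
      using game play \<eta>0 by unfold_locales (simp_all add: \<eta>_def \<tau>_def)
    have H: "\<tau> \<le> real H" "real H \<le> 2 * \<tau>" using \<tau> by (auto simp: H_def) linarith
    have R: "R > 0" using \<tau> c by (simp add: R_def)
    have R2: "real n * (768 * \<eta> * R)\<^sup>2 \<le> 1"
    proof -
      have "768 * \<eta> * R = 1 / sqrt (real n)" using \<tau> c by (simp add: \<eta>_def R_def)
      then show ?thesis using n by (simp add: power_divide)
    qed
    have HR: "real H / R \<le> 1 / 40"
    proof -
      have "real H / R \<le> 2 * \<tau> / R" using H R by (intro divide_right_mono) auto
      also have "\<dots> = 1 / 40" using \<tau> by (simp add: R_def c_def)
      finally show ?thesis .
    qed
    then have HR4: "4 * (real H / R) \<le> 1" by linarith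
    have HR': "real H \<le> R" using HR4 R by (simp add: divide_le_eq)
    have \<eta>H: "\<eta> * real H \<le> 2 * c"
      
    proof -
      have "\<eta> * real H \<le> \<eta> * (2 * \<tau>)" using H \<eta> by (intro mult_left_mono) auto
      then show ?thesis using \<eta>\<tau> by linarith
    qed
    have H3: "exp (6 * \<eta> * real H) * (1 + 4 * (real H / R)) \<le> 3 / 2"
    proof -
      have "exp (6 * \<eta> * real H) \<le> exp (1 / 10)" using \<eta>H by (simp add: c_def)
      also have "\<dots> \<le> 1 + 1 / 10 + (1 / 10)\<^sup>2" by (rule exp_bound) auto
      finally have "exp (6 * \<eta> * real H) \<le> 12 / 10" by (simp add: power2_eq_square)
      then have "exp (6 * \<eta> * real H) * (1 + 4 * (real H / R)) \<le> 12 / 10 * (11 / 10)"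
        using HR R by (intro mult_mono) auto
      then show ?thesis by simp
    qed
    have T16: "real T \<le> 16 ^ H"
    proof -
      have "real T \<le> exp \<tau>" by (simp add: \<tau>_def)
      also have "\<dots> \<le> exp (real H)" using H by simp
      also have "\<dots> = exp 1 ^ H" by (simp flip: exp_of_nat_mult)
      also have "\<dots> \<le> 16 ^ H" using exp_le by (intro power_mono) auto
      finally show ?thesis .
    qed
    have dD: "d i \<le> D" if "i \<in> {1..n}" for i unfolding D_def using that by (intro Max_ge) auto
    have "Gap_CCE n d L (average_play n T x) \<le> (3 * ln (real D) / \<eta>) / real T"
    proof (rule Gap_CCE_le)
      fix i b assume i: "i \<in> {1..n}" and b: "b \<in> {1..d i}"
      have lnD: "ln (real (d i)) \<le> ln (real D)" using dD[OF i] b by (subst ln_le_cancel_iff) auto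
      show "(\<Sum>t\<in>{1..T}. mean {1..d i} (x t i) (l i t) - l i t b) \<le> 3 * ln (real D) / \<eta>"
      proof (cases "d i = 1")
        case True
        then show ?thesis using regret_one_action[OF i b True] lnD \<eta> by simp
      next
        case False
        then have "d i \<ge> 2" using b by auto
        then have "ln 2 \<le> ln (real (d i))" by (subst ln_le_cancel_iff) auto
        moreover have "exp (1 / 2) \<le> (2 :: real)"
          using exp_bound[of "1 / 2"] by (simp add: power2_eq_square)
        then have "1 / 2 \<le> ln (2 :: real)" by (subst ln_ge_iff) auto
        ultimately have "1 \<le> 2 * ln (real D)" using lnD by simp
        moreover have "\<eta> \<le> 1" using \<eta>c by (simp add: c_def)
        \<comment> \<open>Two actions give \<open>ln D \<ge> 1 / 2\<close>, so the additive constant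
          1 is at most \<open>2 * ln D / \<eta>\<close>. This is the origin of the factor 3 in
          \<open>C = 3 / c\<close>.\<close>
        ultimately have one: "1 \<le> 2 * ln (real D) / \<eta>" using \<eta> by (simp add: le_divide_eq)
        have "(\<Sum>t\<in>{1..T}. mean {1..d i} (x t i) (l i t) - l i t b) \<le> ln (real (d i)) / \<eta> + \<eta> * (4 * real H + 22)"
          using H \<tau> HR4 \<eta>c by (intro regret_le[OF R R2 HR' _ HR4 H3 i T16 _ b]) (auto simp: c_def)
        also have "\<eta> * (4 * real H + 22) \<le> 1"
          using \<eta>H \<eta>c by (simp add: distrib_left c_def)
        also have "ln (real (d i)) / \<eta> \<le> ln (real D) / \<eta>"
          using lnD \<eta> by (intro divide_right_mono) auto
        finally show ?thesis using one by (simp add: add_divide_distrib)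
      qed
    qed
    also have "3 * ln (real D) / \<eta> = (3 / c) * sqrt (real n) * ln (real D) * \<tau>"
      using c by (simp add: \<eta>_def)
    finally show ?thesis by (simp add: D_def \<tau>_def)
  qed
  then show ?thesis
    by (intro exI[of _ c] exI[of _ "3 / c"]) (auto simp: c_def)
qed

end
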